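(* Let $\nu\in\mathbb{N}$, $\nu\ge1$, and let $\hat\Theta$ be a solution of the dual problem $\min\{J(\Theta):\Theta\in\mathcal{D}_T\}$. Then $\mathcal{T}_{\hat\Theta,\nu}$ is the closest spectral density to the correlogram $\Omega$, according to the divergence $\mathcal{S}_{B1,\Psi^{-1}}^{(1-\nu^{-1})}(\Omega\|\mathcal{T}_{\Theta,\nu})$, among those belonging to the parametric class $\mathcal{M}_T=\{\mathcal{T}_{\Theta,\nu}:\Theta\in\mathcal{D}_T\}$; that is, $$\hat\Theta=\mathrm{argmin}_{\Theta\in\mathcal{D}_T}\ \mathcal{S}_{B1,\Psi^{-1}}^{(1-\nu^{-1})}(\Omega\|\mathcal{T}_{\Theta,\nu}).$$
   Context: $\mathcal{S}_m^+$ is the set of $m\times m$ spectral densities of $\mathbb{R}^m$-valued stationary processes (Hermitian positive semidefinite functions on the unit circle, with $\Phi(e^{-i\vartheta})=\overline{\Phi(e^{i\vartheta})}$) that are bounded and coercive ($k_1I\preceq\Phi\preceq k_2I$ for some $k_1,k_2>0$). $\mathcal{Q}_n$ is the space of real symmetric $n\times n$ matrices. $\int$ is integration over the unit circle with respect to normalized Lebesgue measure; $*$ is conjugate transpose on the unit circle; inequalities between functions hold on the whole unit circle. Setting: $G(z)=(zI-A)^{-1}B$ with $A\in\mathbb{R}^{n\times n}$ having all eigenvalues in the open unit disc, $B\in\mathbb{R}^{n\times m}$, $n>m$, and $(A,B)$ reachable. $\Psi\in\mathcal{S}_m^+$ is a prior spectral density of bounded McMillan degree (rational), with left square spectral factor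 $W_\Psi$, $\Psi=W_\Psi W_\Psi^*$. $\Omega\succ0$ is the (possibly truncated by the Blackman-Tukey method) biased correlogram computed from data $\mathrm{y}(1),\dots,\mathrm{y}(N)\in\mathbb{R}^m$ (a trigonometric matrix polynomial, so $\Omega\in\mathcal{S}_m^+$), and $\hat\Sigma=\int G\Omega G^*$. For $\Theta\in\mathcal{D}_T=\{\Theta\in\mathcal{Q}_n: I+\nu^{-1}W_\Psi^*G^*\Theta GW_\Psi\succ0\}$ put $$\mathcal{T}_{\Theta,\nu}=W_\Psi(I+\nu^{-1}W_\Psi^*G^*\Theta GW_\Psi)^{-\nu}W_\Psi^*,$$ and define the dual function $$J(\Theta)=\mathrm{tr}\int\log(\Psi^{-1}+G^*\Theta G)^{-1}+\mathrm{tr}(\hat\Sigma\Theta)\quad(\nu=1),$$ $$J(\Theta)=\tfrac{\nu}{\nu-1}\mathrm{tr}\int(I+\nu^{-1}W_\Psi^*G^*\Theta GW_\Psi)^{1-\nu}+\mathrm{tr}(\hat\Sigma\Theta)\quad(\nu>1).$$ It is known that the dual problem $\min_{\mathcal{D}_T}J$ admits solutions and that $\mathcal{T}_{\hat\Theta,\nu}$ is the unique minimizer over $\Phi\in\mathcal{S}_m^+$, subject to $\int G\Phi G^*=\hat\Sigma$, of the Tau divergence $\mathcal{S}_T^{(1-\nu^{-1})}(\Phi\|\Psi)=\mathcal{S}_B^{(1-\nu^{-1})}(W_\Psi^{-1}\Phi W_\Psi^{-*}\|I)$. Divergences: for $\beta\in\mathbb{R}\setminus\{0,1\}$, $\mathcal{S}_B^{(\beta)}(\Phi_1\|\Phi_2)=\mathrm{tr}\int[\frac{1}{\beta(\beta-1)}\Phi_1^\beta-\frac{1}{\beta-1}\Phi_1\Phi_2^{\beta-1}+\frac1\beta\Phi_2^\beta]$;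 for $\beta=0$, by continuity, $\mathcal{S}_B^{(0)}(\Phi_1\|\Phi_2)=\mathcal{S}_{IS}(\Phi_1\|\Phi_2)=\mathrm{tr}\int[\log\Phi_2-\log\Phi_1+\Phi_1\Phi_2^{-1}-I]$. For $Q\in\mathcal{S}_m^+$ with $Q=W_QW_Q^*$ ($W_Q$ square), $\mathcal{S}_{B1,Q}^{(\beta)}(\Phi_1\|\Phi_2)=\mathcal{S}_B^{(\beta)}(W_Q^*\Phi_1W_Q\|W_Q^*\Phi_2W_Q)$; for $\beta=0$ this equals $\mathcal{S}_{IS}(\Phi_1\|\Phi_2)$. In particular, with $Q=\Psi^{-1}$ one may take $W_Q=W_\Psi^{-*}$. *)

theory Defs
  imports "HOL-Analysis.Analysis" "HOL-Computational_Algebra.Polynomial"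
begin

definition hconj :: "complex^'a^'b \<Rightarrow> complex^'b^'a" where
  "hconj M = transpose (map_matrix cnj M)"

definition cmat :: "real^'a^'b \<Rightarrow> complex^'a^'b" where
  "cmat M = map_matrix complex_of_real M"

definition hermitian :: "complex^'a^'a \<Rightarrow> bool" where
  "hermitian M \<longleftrightarrow> hconj M = M"

text \<open>The value \<open>v\<^sup>* M v\<close>; it is real when \<open>M\<close> is Hermitian.\<close>

definition hform :: "complex^'a^'a \<Rightarrow> complex^'a \<Rightarrow> complex" where
  "hform M v = (\<Sum>i\<in>UNIV. cnj (v $ i) * (M *v v) $ i)"

definition psd :: "complex^'a^'a \<Rightarrow> bool" where
  "psd M \<longleftrightarrow> hermitian M \<and> (\<forall>v. 0 \<le> Re (hform M v))"

definition posdef :: "complex^'a^'a \<Rightarrow> bool" where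
  "posdef M \<longleftrightarrow> hermitian M \<and> (\<forall>v. v \<noteq> 0 \<longrightarrow> 0 < Re (hform M v))"

definition unitary_matrix :: "complex^'a^'a \<Rightarrow> bool" where
  "unitary_matrix U \<longleftrightarrow> U ** hconj U = mat 1 \<and> hconj U ** U = mat 1"

definition real_diag :: "('a \<Rightarrow> real) \<Rightarrow> complex^'a^'a" where
  "real_diag d = (\<chi> i j. if i = j then complex_of_real (d i) else 0)"

text \<open>Functional calculus: \<open>f(U D U\<^sup>*) = U f(D) U\<^sup>*\<close> for unitary \<open>U\<close> and real diagonal \<open>D\<close>.
  The result does not depend on the diagonalization. Meaningful for Hermitian arguments only.\<close>

definition herm_fun :: "(real \<Rightarrow> real) \<Rightarrow> complex^'a^'a \<Rightarrow> complex^'a^'a" where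
  "herm_fun f M = (THE X. \<exists>U d. unitary_matrix U
      \<and> M = U ** real_diag d ** hconj U \<and> X = U ** real_diag (f \<circ> d) ** hconj U)"

text \<open>Meaningful for positive definite arguments only, in view of the conventions of
  \<^const>\<open>powr\<close> and \<^const>\<open>ln\<close> outside the positive half-line.\<close>

definition mpowr :: "complex^'a^'a \<Rightarrow> real \<Rightarrow> complex^'a^'a" where
  "mpowr M s = herm_fun (\<lambda>x. x powr s) M"

definition mlog :: "complex^'a^'a \<Rightarrow> complex^'a^'a" where
  "mlog M = herm_fun ln M"

text \<open>Matrix functions are total functions on the complex plane; only their values on the
  unit circle matter.\<close>

abbreviation unit_circle :: "complex set" where
  "unit_circle \<equiv> sphere 0 1"

definition circle_measurable :: "(complex \<Rightarrow> complex^'a^'b) \<Rightarrow> bool" where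
  "circle_measurable F \<longleftrightarrow> (\<lambda>t. F (cis t)) \<in> borel_measurable lborel"

definition circle_integral :: "(complex \<Rightarrow> complex^'a^'b) \<Rightarrow> complex^'a^'b" where
  "circle_integral F = (1 / (2 * pi)) *\<^sub>R (LINT t:{-pi..pi}|lborel. F (cis t))"

text \<open>Traces of integrals below are real for the Hermitian (or trace-real) integrands to which
  the definition is applied.\<close>

definition tr_int :: "(complex \<Rightarrow> complex^'a^'a) \<Rightarrow> real" where
  "tr_int F = Re (trace (circle_integral F))"

text \<open>\<open>\<S>\<^sub>m\<^sup>+\<close>: bounded coercive spectral densities of real-valued processes.\<close>

definition spec_densities :: "(complex \<Rightarrow> complex^'m^'m) set" where
  "spec_densities = {\<Phi>. circle_measurable \<Phi>
      \<and> (\<forall>z\<in>unit_circle. hermitian (\<Phi> z) \<and> \<Phi> (cnj z) = map_matrix cnj (\<Phi> z))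
      \<and> (\<exists>k1>0. \<exists>k2>0. \<forall>z\<in>unit_circle.
            psd (\<Phi> z - k1 *\<^sub>R mat 1) \<and> psd (k2 *\<^sub>R mat 1 - \<Phi> z))}"

text \<open>Bounded McMillan degree: a rational function that is bounded on the circle has no poles there.\<close>

definition rational_on_circle :: "(complex \<Rightarrow> complex^'a^'b) \<Rightarrow> bool" where
  "rational_on_circle F \<longleftrightarrow> (\<forall>i j. \<exists>p q :: complex poly. \<forall>z\<in>unit_circle.
      poly q z \<noteq> 0 \<and> F z $ i $ j = poly p z / poly q z)"

definition spectral_factor ::
  "(complex \<Rightarrow> complex^'m^'m) \<Rightarrow> (complex \<Rightarrow> complex^'m^'m) \<Rightarrow> bool" where
  "spectral_factor W \<Phi> \<longleftrightarrow> circle_measurable W \<and> (\<forall>z\<in>unit_circle. \<Phi> z = W z ** hconj (W z))"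

definition schur_stable :: "real^'n^'n \<Rightarrow> bool" where
  "schur_stable A \<longleftrightarrow> (\<forall>c v. v \<noteq> 0 \<and> cmat A *v v = c *s v \<longrightarrow> cmod c < 1)"

text \<open>Full rank of \<open>[B, A B, \<dots>, A\<^bsup>n-1\<^esup> B]\<close>.\<close>

definition reachable :: "real^'n^'n \<Rightarrow> real^'m^'n \<Rightarrow> bool" where
  "reachable A B \<longleftrightarrow>
     span (\<Union>k<CARD('n). range (\<lambda>u. (((*v) A) ^^ k) (B *v u))) = UNIV"

definition transfer_fun :: "real^'n^'n \<Rightarrow> real^'m^'n \<Rightarrow> complex \<Rightarrow> complex^'m^'n" where
  "transfer_fun A B z = matrix_inv (mat z - cmat A) ** cmat B"

text \<open>Biased estimate of the covariance lag \<open>E[y(t+k) y(t)\<^sup>T]\<close> from \<open>y(1), \<dots>, y(N)\<close>.\<close>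

definition sample_cov :: "nat \<Rightarrow> (nat \<Rightarrow> real^'m) \<Rightarrow> nat \<Rightarrow> real^'m^'m" where
  "sample_cov N y k = (1 / real N) *\<^sub>R (\<Sum>t=1..N-k. \<chi> i j. y (t + k) $ i * y t $ j)"

definition sample_cov_int :: "nat \<Rightarrow> (nat \<Rightarrow> real^'m) \<Rightarrow> int \<Rightarrow> real^'m^'m" where
  "sample_cov_int N y k =
     (if 0 \<le> k then sample_cov N y (nat k) else transpose (sample_cov N y (nat (- k))))"

text \<open>Blackman--Tukey estimate with lag window \<open>w\<close> and lags \<open>\<bar>k\<bar> < L\<close>. The plain biased
  correlogram is the case \<open>L = N\<close>, \<open>w = 1\<close>; plain truncation is \<open>L < N\<close>, \<open>w = 1\<close>.\<close>

definition correlogram ::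
  "(nat \<Rightarrow> real) \<Rightarrow> nat \<Rightarrow> nat \<Rightarrow> (nat \<Rightarrow> real^'m) \<Rightarrow> complex \<Rightarrow> complex^'m^'m" where
  "correlogram w L N y z = (\<Sum>k\<in>{- int L<..<int L}.
      mat (complex_of_real (w (nat \<bar>k\<bar>)) * z powi (- k)) ** cmat (sample_cov_int N y k))"

definition is_div ::
  "(complex \<Rightarrow> complex^'m^'m) \<Rightarrow> (complex \<Rightarrow> complex^'m^'m) \<Rightarrow> real" where
  "is_div \<Phi>1 \<Phi>2 = tr_int (\<lambda>z. mlog (\<Phi>2 z) - mlog (\<Phi>1 z) + \<Phi>1 z ** matrix_inv (\<Phi>2 z) - mat 1)"

text \<open>Meaningful for \<open>\<beta> \<noteq> 1\<close> only; the value at \<open>\<beta> = 0\<close> is the limit (Itakura--Saito).\<close>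

definition beta_div ::
  "real \<Rightarrow> (complex \<Rightarrow> complex^'m^'m) \<Rightarrow> (complex \<Rightarrow> complex^'m^'m) \<Rightarrow> real" where
  "beta_div \<beta> \<Phi>1 \<Phi>2 =
     (if \<beta> = 0 then is_div \<Phi>1 \<Phi>2
      else tr_int (\<lambda>z. (1 / (\<beta> * (\<beta> - 1))) *\<^sub>R mpowr (\<Phi>1 z) \<beta>
                     - (1 / (\<beta> - 1)) *\<^sub>R (\<Phi>1 z ** mpowr (\<Phi>2 z) (\<beta> - 1))
                     + (1 / \<beta>) *\<^sub>R mpowr (\<Phi>2 z) \<beta>))"

text \<open>The weighted beta divergence \<open>\<S>\<^sub>B\<^sub>1\<^sub>,\<^sub>Q\<close>, in terms of a square factor \<open>WQ\<close> of
  \<open>Q = WQ WQ\<^sup>*\<close>; its value depends on \<open>Q\<close> only.\<close>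

definition weighted_beta_div :: "(complex \<Rightarrow> complex^'m^'m) \<Rightarrow> real
    \<Rightarrow> (complex \<Rightarrow> complex^'m^'m) \<Rightarrow> (complex \<Rightarrow> complex^'m^'m) \<Rightarrow> real" where
  "weighted_beta_div WQ \<beta> \<Phi>1 \<Phi>2 =
     beta_div \<beta> (\<lambda>z. hconj (WQ z) ** \<Phi>1 z ** WQ z) (\<lambda>z. hconj (WQ z) ** \<Phi>2 z ** WQ z)"

definition dual_kernel :: "(complex \<Rightarrow> complex^'m^'n) \<Rightarrow> (complex \<Rightarrow> complex^'m^'m) \<Rightarrow> nat
    \<Rightarrow> real^'n^'n \<Rightarrow> complex \<Rightarrow> complex^'m^'m" where
  "dual_kernel G W \<nu> \<Theta> z =
     mat 1 + (1 / real \<nu>) *\<^sub>R (hconj (W z) ** hconj (G z) ** cmat \<Theta> ** G z ** W z)"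

definition dual_domain ::
  "(complex \<Rightarrow> complex^'m^'n) \<Rightarrow> (complex \<Rightarrow> complex^'m^'m) \<Rightarrow> nat \<Rightarrow> (real^'n^'n) set" where
  "dual_domain G W \<nu> =
     {\<Theta>. transpose \<Theta> = \<Theta> \<and> (\<forall>z\<in>unit_circle. posdef (dual_kernel G W \<nu> \<Theta> z))}"

definition tau_density :: "(complex \<Rightarrow> complex^'m^'n) \<Rightarrow> (complex \<Rightarrow> complex^'m^'m) \<Rightarrow> nat
    \<Rightarrow> real^'n^'n \<Rightarrow> complex \<Rightarrow> complex^'m^'m" where
  "tau_density G W \<nu> \<Theta> z =
     W z ** mpowr (dual_kernel G W \<nu> \<Theta> z) (- real \<nu>) ** hconj (W z)"

definition tau_class :: "(complex \<Rightarrow> complex^'m^'n) \<Rightarrow> (complex \<Rightarrow> complex^'m^'m) \<Rightarrow> nat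
    \<Rightarrow> (complex \<Rightarrow> complex^'m^'m) set" where
  "tau_class G W \<nu> = tau_density G W \<nu> ` dual_domain G W \<nu>"

definition dual_fun :: "(complex \<Rightarrow> complex^'m^'n) \<Rightarrow> (complex \<Rightarrow> complex^'m^'m)
    \<Rightarrow> (complex \<Rightarrow> complex^'m^'m) \<Rightarrow> complex^'n^'n \<Rightarrow> nat \<Rightarrow> real^'n^'n \<Rightarrow> real" where
  "dual_fun G \<Psi> W \<Sigma> \<nu> \<Theta> =
     (if \<nu> = 1
      then tr_int (\<lambda>z. mlog (matrix_inv (matrix_inv (\<Psi> z) + hconj (G z) ** cmat \<Theta> ** G z)))
      else real \<nu> / (real \<nu> - 1) * tr_int (\<lambda>z. mpowr (dual_kernel G W \<nu> \<Theta> z) (1 - real \<nu>)))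
     + Re (trace (\<Sigma> ** cmat \<Theta>))"

end

theory Submission
  imports Defs
begin

text \<open>The weighted divergence of the data from a member of the family and the dual function differ by a
  constant on the dual domain, so that they have the same minimizers. Both are, up to constants,
  \<open>tr \<integral> f (K \<Theta>) + tr \<integral> \<Omega> G\<^sup>* \<Theta> G\<close>, where \<open>K\<close> is the dual kernel \<open>I + \<nu>\<^sup>-\<^sup>1 W\<^sup>* G\<^sup>* \<Theta> G W\<close>, and \<open>f\<close> is
  \<open>- ln\<close> for \<open>\<nu> = 1\<close> and \<open>\<nu> / (\<nu> - 1) x\<^bsup>1 - \<nu>\<^esup>\<close> otherwise. For the dual function (\<open>dual_fun_eq\<close>) the linear
  term is \<open>tr (\<Sigma> \<Theta>)\<close>. For the divergence (\<open>weighted_beta_div_eq\<close>) the weight turns the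
  density into \<open>K\<^bsup>-\<nu>\<^esup>\<close> up to a unitary change of basis. The exponent \<open>\<beta> - 1 = - 1 / \<nu>\<close> in the mixed term
  turns this into \<open>K\<close>, which is affine in \<open>\<Theta>\<close>, and the exponent \<open>\<beta>\<close> in the last term turns it into
  \<open>K\<^bsup>1 - \<nu>\<^esup>\<close>.

  A minimizer need not be unique, since different \<open>\<Theta>\<close> can have the same \<open>G\<^sup>* \<Theta> G\<close> on the circle, but the
  density is: at the midpoint of two minimizers, Klein's trace inequality for the strictly convex \<open>f\<close>
  (\<open>klein_inequality\<close>) shows that the kernels agree almost everywhere. Then \<open>G\<^sup>* \<Theta> G\<close> agrees almost
  everywhere, and everywhere by continuity (\<open>reduced_dual_minimizers_agree\<close>).

  The spectral factors are only measurable. Integrability of every integrand therefore rests on the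
  measurability of the functional calculus (\<open>circle_bdd_herm_fun\<close>), whereas bounds come from
  \<open>\<Psi>\<^sup>-\<^sup>1 + \<nu>\<^sup>-\<^sup>1 G\<^sup>* \<Theta> G\<close>, which is congruent to the kernel and continuous, hence uniformly positive on the
  compact circle.\<close>

section \<open>Conjugate transposes, inverses and the real inner product\<close>

text \<open>The general rule \<open>scaleR_conv_of_real\<close> also rewrites scalar multiples of matrices, where
  \<open>of_real\<close> is not a multiple of the identity matrix; only the instance for numbers is wanted.\<close>

lemma complex_scaleR: "c *\<^sub>R z = complex_of_real c * z" for z :: complex
  by (rule scaleR_conv_of_real)

lemma matrix_add_rdistrib: "(A + B) ** C = A ** C + B ** C"
  for A B :: "'a::semiring_1^'n^'m"
  by (simp add: vec_eq_iff matrix_matrix_mult_def sum.distrib algebra_simps)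

lemma matrix_diff_rdistrib: "(A - B) ** C = A ** C - B ** C"
  for A B :: "'a::ring_1^'n^'m"
  by (simp add: vec_eq_iff matrix_matrix_mult_def sum_subtractf algebra_simps)

lemma hconj_nth [simp]: "hconj M $ i $ j = cnj (M $ j $ i)"
  by (simp add: hconj_def transpose_def)

lemma hconj_hconj [simp]: "hconj (hconj M) = M"
  by (simp add: vec_eq_iff)

lemma hconj_mult: "hconj (A ** B) = hconj B ** hconj A"
  by (simp add: vec_eq_iff matrix_matrix_mult_def mult.commute)

lemma hconj_add: "hconj (A + B) = hconj A + hconj B"
  by (simp add: vec_eq_iff)

lemma hconj_scaleR: "hconj (c *\<^sub>R A) = c *\<^sub>R hconj A"
  by (simp add: vec_eq_iff)

lemma hconj_mat_1 [simp]: "hconj (mat 1) = mat 1"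
  by (simp add: vec_eq_iff mat_def)

lemma hconj_real_diag [simp]: "hconj (real_diag d) = real_diag d"
  by (simp add: vec_eq_iff real_diag_def)

lemma matrix_mult_1_comm:
  fixes A B :: "'a::field^'n^'n"
  shows "A ** B = mat 1 \<Longrightarrow> B ** A = mat 1"
  using matrix_left_right_inverse by blast

lemma matrix_inv_eqI:
  fixes A B :: "'a::field^'n^'n"
  assumes "A ** B = mat 1"
  shows "matrix_inv A = B"
proof -
  have BA: "B ** A = mat 1" using assms by (rule matrix_mult_1_comm)
  have "A ** matrix_inv A = mat 1"
    unfolding matrix_inv_def using someI[of "\<lambda>X. A ** X = mat 1 \<and> X ** A = mat 1" B] assms BA by blast
  then have "B ** (A ** matrix_inv A) = B" by simp
  then show ?thesis by (simp add: matrix_mul_assoc BA)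
qed

lemma matrix_inv_cancel:
  fixes A :: "'a::field^'n^'n"
  assumes "invertible A"
  shows "A ** matrix_inv A = mat 1" "matrix_inv A ** A = mat 1"
proof -
  obtain B where "A ** B = mat 1" using assms unfolding invertible_def by blast
  then show "A ** matrix_inv A = mat 1" "matrix_inv A ** A = mat 1"
    using matrix_inv_eqI matrix_mult_1_comm by metis+
qed

lemma real_diag_nth: "real_diag d $ i $ j = (if i = j then complex_of_real (d i) else 0)"
  by (simp add: real_diag_def)

lemma real_diag_mult: "real_diag c ** real_diag d = real_diag (\<lambda>i. c i * d i)"
  by (simp add: vec_eq_iff matrix_matrix_mult_def real_diag_nth if_distrib[where f="\<lambda>x. x * _"]
      if_distrib[where f="\<lambda>x. _ * x"] cong: if_cong)

lemma real_diag_mult_nth: "(real_diag d ** M) $ i $ j = complex_of_real (d i) * M $ i $ j"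
  by (simp add: matrix_matrix_mult_def real_diag_nth if_distrib[where f="\<lambda>x. x * _"] cong: if_cong)

lemma mult_real_diag_nth: "(M ** real_diag d) $ i $ j = M $ i $ j * complex_of_real (d j)"
  by (simp add: matrix_matrix_mult_def real_diag_nth if_distrib[where f="\<lambda>x. _ * x"] cong: if_cong)

lemma real_diag_const: "real_diag (\<lambda>i. c) = c *\<^sub>R mat 1"
  by (simp add: vec_eq_iff real_diag_nth mat_def complex_scaleR)

lemma inner_complex_vec: "x \<bullet> y = Re (\<Sum>i\<in>UNIV. cnj (x $ i) * y $ i)"
  for x y :: "complex^'n"
  by (simp add: inner_vec_def inner_complex_def)

lemma Re_hform: "Re (hform M v) = v \<bullet> (M *v v)"
  by (simp add: hform_def inner_complex_vec)

lemma inner_matrix_vector: "x \<bullet> (M *v y) = (hconj M *v x) \<bullet> y"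
  for M :: "complex^'n^'m"
proof -
  have "(\<Sum>i\<in>UNIV. cnj (x $ i) * (M *v y) $ i) = (\<Sum>i\<in>UNIV. \<Sum>j\<in>UNIV. cnj (x $ i) * M $ i $ j * y $ j)"
    by (simp add: matrix_vector_mult_def sum_distrib_left mult.assoc)
  also have "\<dots> = (\<Sum>j\<in>UNIV. \<Sum>i\<in>UNIV. cnj (x $ i) * M $ i $ j * y $ j)"
    by (rule sum.swap)
  also have "\<dots> = (\<Sum>j\<in>UNIV. cnj ((hconj M *v x) $ j) * y $ j)"
  proof (rule sum.cong)
    fix j
    have "cnj ((hconj M *v x) $ j) = (\<Sum>i\<in>UNIV. cnj (x $ i) * M $ i $ j)"
      by (simp add: matrix_vector_mult_def mult.commute)
    then show "(\<Sum>i\<in>UNIV. cnj (x $ i) * M $ i $ j * y $ j) = cnj ((hconj M *v x) $ j) * y $ j"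
      by (simp add: sum_distrib_right)
  qed simp
  finally show ?thesis by (simp add: inner_complex_vec)
qed

section \<open>The spectral theorem for Hermitian matrices\<close>

text \<open>The Rayleigh quotient attains its maximum on the unit sphere of the invariant subspace. At a
  maximizer \<open>v\<close> with value \<open>\<lambda>\<close>, moving in the direction of the residual \<open>T v - \<lambda> v\<close> would increase
  the quotient to first order unless the residual vanishes.\<close>

lemma selfadjoint_eigenvector:
  fixes T :: "'a::euclidean_space \<Rightarrow> 'a"
  assumes lin: "linear T" and sa: "\<And>x y. T x \<bullet> y = x \<bullet> T y"
    and V: "subspace V" "\<And>x. x \<in> V \<Longrightarrow> T x \<in> V" "x0 \<in> V" "x0 \<noteq> 0"
  obtains v c where "v \<in> V" "norm v = 1" "T v = c *\<^sub>R v"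
proof -
  let ?K = "V \<inter> sphere 0 1"
  have K: "compact ?K"
    using V(1) by (simp add: closed_subspace closed_Int_compact)
  have "x0 /\<^sub>R norm x0 \<in> ?K" using V by (simp add: subspace_scale)
  then have ne: "?K \<noteq> {}" by blast
  have cont: "continuous_on ?K (\<lambda>x. x \<bullet> T x)"
    by (intro continuous_intros linear_continuous_on linear_linear[THEN iffD2] lin)
  obtain v where v: "v \<in> ?K" and vmax: "\<And>x. x \<in> ?K \<Longrightarrow> x \<bullet> T x \<le> v \<bullet> T v"
    using continuous_attains_sup[OF K ne cont] by blast
  define c where "c = v \<bullet> T v"
  have quad: "x \<bullet> T x \<le> c * (x \<bullet> x)" if "x \<in> V" for x
  proof (cases "x = 0")
    case True
    then show ?thesis by simp
  next
    case False
    have "x /\<^sub>R norm x \<in> ?K" using that False V by (simp add: subspace_scale)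
    from vmax[OF this] have "(x \<bullet> T x) / (norm x)^2 \<le> c"
      by (simp add: c_def linear_scale[OF lin] power2_eq_square divide_inverse mult_ac)
    then show ?thesis using False by (simp add: field_simps power2_norm_eq_inner)
  qed
  \<comment> \<open>the residual, which is also the direction of the perturbation\<close>
  define r where "r = T v - c *\<^sub>R v"
  have rV: "r \<in> V" unfolding r_def using V v by (auto intro!: subspace_diff subspace_scale)
  have vv: "v \<bullet> v = 1" using v by (simp add: norm_eq_1)
  define k where "k = c * (r \<bullet> r) - r \<bullet> T r"
  have step: "2 * t * (r \<bullet> r) \<le> t^2 * k" for t :: real
  proof -
    have "v + t *\<^sub>R r \<in> V" using V v rV by (auto intro!: subspace_add subspace_scale)
    from quad[OF this]
    have "c + 2 * t * (r \<bullet> T v) + t^2 * (r \<bullet> T r) \<le> c * (1 + 2 * t * (r \<bullet> v) + t^2 * (r \<bullet> r))"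
      using sa[of v r]
      by (simp add: linear_add[OF lin] linear_scale[OF lin] inner_add vv c_def[symmetric]
          power2_eq_square inner_commute algebra_simps)
    moreover
    have "r \<bullet> r = r \<bullet> T v - c * (r \<bullet> v)"
      by (subst (2) r_def) (simp add: inner_diff_right)
    then have "2 * t * (r \<bullet> r) = 2 * t * (r \<bullet> T v) - 2 * t * (c * (r \<bullet> v))"
      by (simp only: right_diff_distrib)
    moreover have "t^2 * k = c * (t^2 * (r \<bullet> r)) - t^2 * (r \<bullet> T r)"
      by (simp add: k_def algebra_simps)
    ultimately show ?thesis by (simp add: algebra_simps)
  qed
  have "r \<bullet> r = 0"
  proof (rule ccontr)
    assume "r \<bullet> r \<noteq> 0"
    then have pos: "r \<bullet> r > 0" by (simp add: less_le)
    \<comment> \<open>small enough for the quadratic term to lose against the linear one\<close>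
    define t where "t = (r \<bullet> r) / (\<bar>k\<bar> + 1)"
    have t: "t > 0" using pos by (simp add: t_def add_nonneg_pos)
    have "2 * (r \<bullet> r) \<le> t * k" using step[of t] t by (simp add: power2_eq_square)
    also have "\<dots> \<le> t * (\<bar>k\<bar> + 1)" using t by (simp add: mult_left_mono)
    also have "\<dots> = r \<bullet> r" by (simp add: t_def field_simps)
    finally show False using pos by simp
  qed
  then have "T v = c *\<^sub>R v" by (simp add: r_def)
  then show thesis using that[of v c] v by auto
qed

abbreviation cinner :: "complex^'n \<Rightarrow> complex^'n \<Rightarrow> complex" where
  "cinner x y \<equiv> (\<Sum>i\<in>UNIV. cnj (x $ i) * y $ i)"

lemma cinner_eq_inner: "cinner x y = Complex (x \<bullet> y) ((\<i> *s x) \<bullet> y)"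
  by (simp add: complex_eq_iff inner_complex_vec)

text \<open>An orthonormal system of eigenvectors indexed by a proper subset \<open>S\<close> of the index type can be
  enlarged: its complex span has at most \<open>2 * card S\<close> real dimensions, its orthogonal complement is
  therefore nonzero, and that complement is invariant.\<close>

lemma orthonormal_eigenvectors:
  fixes M :: "complex^'n^'n"
  assumes M: "hermitian M" and "finite S"
  shows "\<exists>u d. \<forall>i\<in>S. M *v u i = complex_of_real (d i) *s u i
           \<and> (\<forall>j\<in>S. cinner (u i) (u j) = (if i = (j::'n) then 1 else 0))"
  using \<open>finite S\<close>
proof (induction S rule: finite_induct)
  case empty
  then show ?case by simp
next
  case (insert a S)
  then obtain u d where u: "\<And>i. i \<in> S \<Longrightarrow> M *v u i = complex_of_real (d i) *s u i"
    and on: "\<And>i j. i \<in> S \<Longrightarrow> j \<in> S \<Longrightarrow> cinner (u i) (u j) = (if i = j then 1 else 0)"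
    by metis
  \<comment> \<open>orthogonality to \<open>u i\<close> over the complex numbers is real orthogonality to \<open>u i\<close> and \<open>\<i> u i\<close>\<close>
  define F where "F = u ` S \<union> (\<lambda>i. \<i> *s u i) ` S"
  define V where "V = {x. \<forall>y\<in>F. y \<bullet> x = 0}"
  have V_iff: "x \<in> V \<longleftrightarrow> (\<forall>i\<in>S. cinner (u i) x = 0)" for x
    by (auto simp: V_def F_def cinner_eq_inner complex_eq_iff)
  have "card F \<le> card S + card S"
    unfolding F_def
    by (rule order_trans[OF card_Un_le]) (intro add_mono card_image_le insert)
  moreover have "card S < CARD('n)"
    using insert.hyps by (intro psubset_card_mono) auto
  moreover have "dim F \<le> card F"
    by (intro dim_le_card') (simp add: F_def insert)
  ultimately have "dim F < DIM(complex^'n)" by simp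
  then obtain x0 where x0: "x0 \<noteq> 0" "\<And>y. y \<in> span F \<Longrightarrow> orthogonal x0 y"
    using orthogonal_to_subspace_exists by blast
  have "x0 \<in> V" using x0(2) by (auto simp: V_def orthogonal_def inner_commute intro: span_base)
  have sub: "subspace V" by (auto simp: V_def subspace_def inner_add_right)
  have sa: "(M *v x) \<bullet> y = x \<bullet> (M *v y)" for x y
    using M by (simp add: inner_matrix_vector hermitian_def)
  have inv: "M *v x \<in> V" if "x \<in> V" for x
  proof -
    have "y \<bullet> (M *v x) = 0" if y: "y \<in> F" for y
    proof -
      obtain i b where i: "i \<in> S" and b: "y = b *s u i"
        using y unfolding F_def by (metis (no_types, lifting) UnE imageE vector_smult_lid)
      have "M *v y = complex_of_real (d i) *s y"
        using u[OF i] by (simp add: b vec.scale mult.commute)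
      also have "\<dots> = d i *\<^sub>R y" by (simp add: vec_eq_iff complex_scaleR)
      finally have "M *v y = d i *\<^sub>R y" .
      then have "y \<bullet> (M *v x) = d i * (y \<bullet> x)" using sa[of y x] by simp
      then show ?thesis using \<open>x \<in> V\<close> y by (simp add: V_def)
    qed
    then show ?thesis by (simp add: V_def)
  qed
  obtain v c where v: "v \<in> V" "norm v = 1" "M *v v = c *\<^sub>R v"
    using selfadjoint_eigenvector[of "(*v) M" V x0] sa sub inv \<open>x0 \<in> V\<close> \<open>x0 \<noteq> 0\<close> by auto
  have uv: "cinner (u i) v = 0" if "i \<in> S" for i using v(1) that by (simp add: V_iff)
  have vu: "cinner v (u i) = 0" if "i \<in> S" for i
    using arg_cong[OF uv[OF that], of cnj] by (simp add: mult.commute)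
  have "cinner v v = 1"
    using v(2) by (simp add: norm_eq_1 inner_vec_def inner_complex_def complex_eq_iff mult.commute)
  then have "\<forall>i\<in>insert a S. M *v (u(a := v)) i = complex_of_real ((d(a := c)) i) *s (u(a := v)) i
           \<and> (\<forall>j\<in>insert a S. cinner ((u(a := v)) i) ((u(a := v)) j) = (if i = j then 1 else 0))"
    using insert.hyps u on uv vu v(3)
    by (auto simp: vec_eq_iff complex_scaleR)
  then show ?case by (intro exI)
qed

theorem hermitian_diagonalizable:
  fixes M :: "complex^'n^'n"
  assumes "hermitian M"
  obtains U d where "unitary_matrix U" "M = U ** real_diag d ** hconj U"
proof -
  obtain u :: "'n \<Rightarrow> complex^'n" and d :: "'n \<Rightarrow> real" where ud: "\<forall>i\<in>UNIV. M *v u i = complex_of_real (d i) *s u i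
      \<and> (\<forall>j\<in>UNIV. cinner (u i) (u j) = (if i = j then 1 else 0))"
    using orthonormal_eigenvectors[OF assms finite[of UNIV]] by blast
  have u: "M *v u i = complex_of_real (d i) *s u i" for i using ud by blast
  have on: "cinner (u i) (u j) = (if i = j then 1 else 0)" for i j using ud by blast
  define U where "U = (\<chi> i j. u j $ i)"
  have "hconj U ** U = mat 1"
    by (simp add: vec_eq_iff matrix_matrix_mult_def U_def mat_def on)
  then have U: "unitary_matrix U"
    by (simp add: unitary_matrix_def matrix_mult_1_comm)
  have "(M ** U) $ i $ j = (M *v u j) $ i" for i j
    by (simp add: matrix_matrix_mult_def matrix_vector_mult_def U_def)
  then have "M ** U = U ** real_diag d"
    by (simp add: vec_eq_iff u mult_real_diag_nth U_def mult.commute)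
  then have "U ** real_diag d ** hconj U = M ** (U ** hconj U)"
    by (simp add: matrix_mul_assoc)
  also have "\<dots> = M" using U by (simp add: unitary_matrix_def)
  finally show thesis using that U by metis
qed

section \<open>Functional calculus\<close>

lemma unitary_matrixD:
  assumes "unitary_matrix U"
  shows "U ** hconj U = mat 1" "hconj U ** U = mat 1"
    "X ** U ** hconj U = X" "Y ** hconj U ** U = Y"
  using assms by (simp_all add: unitary_matrix_def flip: matrix_mul_assoc)

text \<open>Two diagonalizations of the same matrix differ by a unitary matrix that intertwines the two
  diagonals; its nonzero entries link equal eigenvalues only, so it intertwines the images under \<open>f\<close>
  as well.\<close>

lemma herm_fun_diag:
  assumes U: "unitary_matrix U"
  shows "herm_fun f (U ** real_diag d ** hconj U) = U ** real_diag (f \<circ> d) ** hconj U"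
  unfolding herm_fun_def
proof (rule the_equality)
  show "\<exists>V e. unitary_matrix V \<and> U ** real_diag d ** hconj U = V ** real_diag e ** hconj V
      \<and> U ** real_diag (f \<circ> d) ** hconj U = V ** real_diag (f \<circ> e) ** hconj V"
    using U by blast
next
  fix X
  assume "\<exists>V e. unitary_matrix V \<and> U ** real_diag d ** hconj U = V ** real_diag e ** hconj V
      \<and> X = V ** real_diag (f \<circ> e) ** hconj V"
  then obtain V e where V: "unitary_matrix V"
    and eq: "U ** real_diag d ** hconj U = V ** real_diag e ** hconj V"
    and X: "X = V ** real_diag (f \<circ> e) ** hconj V" by blast
  define Q where "Q = hconj V ** U"
  have "hconj V ** (U ** real_diag d ** hconj U) ** U = hconj V ** (V ** real_diag e ** hconj V) ** U"
    by (simp only: eq)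
  then have "Q ** real_diag d = real_diag e ** Q"
    by (simp add: Q_def matrix_mul_assoc unitary_matrixD[OF U] unitary_matrixD[OF V])
  then have "Q $ i $ j * complex_of_real (d j) = complex_of_real (e i) * Q $ i $ j" for i j
    by (metis real_diag_mult_nth mult_real_diag_nth)
  then have "Q $ i $ j = 0 \<or> d j = e i" for i j
    by (metis mult.commute mult_right_cancel of_real_eq_iff)
  then have "Q ** real_diag (f \<circ> d) = real_diag (f \<circ> e) ** Q"
    by (simp add: vec_eq_iff real_diag_mult_nth mult_real_diag_nth) (metis mult.commute mult_zero_left)
  then have "V ** (Q ** real_diag (f \<circ> d)) ** hconj U = V ** (real_diag (f \<circ> e) ** Q) ** hconj U"
    by simp
  then show "X = U ** real_diag (f \<circ> d) ** hconj U"
    by (simp add: X Q_def matrix_mul_assoc unitary_matrixD[OF U] unitary_matrixD[OF V])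
qed

lemma hermitian_diag: "hermitian (U ** real_diag d ** hconj U)"
  by (simp add: hermitian_def hconj_mult matrix_mul_assoc)

lemma hform_diag:
  "Re (hform (U ** real_diag d ** hconj U) v) = (\<Sum>i\<in>UNIV. d i * (cmod ((hconj U *v v) $ i))\<^sup>2)"
proof -
  let ?w = "hconj U *v v"
  have "Re (hform (U ** real_diag d ** hconj U) v) = ?w \<bullet> (real_diag d *v ?w)"
    by (simp add: Re_hform inner_matrix_vector flip: matrix_vector_mul_assoc)
  also have "real_diag d *v ?w = (\<chi> i. complex_of_real (d i) * ?w $ i)"
    by (simp add: vec_eq_iff matrix_vector_mult_def[of "real_diag d"] real_diag_nth
        if_distrib[where f="\<lambda>x. x * _"] cong: if_cong)
  also have "?w \<bullet> \<dots> = (\<Sum>i\<in>UNIV. d i * (cmod (?w $ i))\<^sup>2)"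
    by (simp add: inner_vec_def inner_complex_def cmod_power2)
      (simp add: power2_eq_square algebra_simps)
  finally show ?thesis .
qed

lemma hform_diag_axis:
  assumes "unitary_matrix U"
  shows "Re (hform (U ** real_diag d ** hconj U) (U *v axis i 1)) = d i" "U *v axis i 1 \<noteq> 0"
proof -
  have w: "hconj U *v (U *v axis i 1) = axis i 1"
    by (simp add: matrix_vector_mul_assoc unitary_matrixD[OF assms])
  have "Re (hform (U ** real_diag d ** hconj U) (U *v axis i 1))
      = (\<Sum>k\<in>UNIV. if k = i then d i else 0)"
    unfolding hform_diag w by (intro sum.cong) (auto simp: axis_def)
  then show "Re (hform (U ** real_diag d ** hconj U) (U *v axis i 1)) = d i" by simp
  show "U *v axis i 1 \<noteq> 0"
    using w by (metis axis_eq_0_iff matrix_vector_mult_0_right zero_neq_one)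
qed

lemma psd_diag:
  assumes "unitary_matrix U"
  shows "psd (U ** real_diag d ** hconj U) \<longleftrightarrow> (\<forall>i. 0 \<le> d i)"
proof
  assume "psd (U ** real_diag d ** hconj U)"
  then show "\<forall>i. 0 \<le> d i" unfolding psd_def by (metis hform_diag_axis(1)[OF assms])
qed (simp add: psd_def hermitian_diag hform_diag sum_nonneg)

lemma posdef_diag:
  assumes U: "unitary_matrix U"
  shows "posdef (U ** real_diag d ** hconj U) \<longleftrightarrow> (\<forall>i. 0 < d i)"
proof
  assume "posdef (U ** real_diag d ** hconj U)"
  then show "\<forall>i. 0 < d i"
    unfolding posdef_def by (metis hform_diag_axis[OF assms])
next
  assume d: "\<forall>i. 0 < d i"
  have "0 < Re (hform (U ** real_diag d ** hconj U) v)" if "v \<noteq> 0" for v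
  proof -
    have "U *v (hconj U *v v) = v" by (simp add: matrix_vector_mul_assoc unitary_matrixD[OF U])
    then have "hconj U *v v \<noteq> 0" using that by (metis matrix_vector_mult_0_right)
    then obtain i where "(hconj U *v v) $ i \<noteq> 0" by (auto simp: vec_eq_iff)
    then show ?thesis unfolding hform_diag
      using d by (intro sum_pos2[of UNIV i]) (simp_all add: less_imp_le)
  qed
  then show "posdef (U ** real_diag d ** hconj U)" by (simp add: posdef_def hermitian_diag)
qed

lemma posdef_imp_hermitian: "posdef M \<Longrightarrow> hermitian M"
  by (simp add: posdef_def)

lemma posdef_diagonalizable:
  assumes "posdef M"
  obtains U d where "unitary_matrix U" "M = U ** real_diag d ** hconj U" "\<forall>i. 0 < d i"
  using assms hermitian_diagonalizable[OF posdef_imp_hermitian] posdef_diag by metis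

lemma hermitian_herm_fun: "hermitian M \<Longrightarrow> hermitian (herm_fun f M)"
  by (metis herm_fun_diag hermitian_diag hermitian_diagonalizable)

lemma herm_fun_id: "hermitian M \<Longrightarrow> herm_fun (\<lambda>x. x) M = M"
  by (erule hermitian_diagonalizable) (simp add: herm_fun_diag comp_def)

lemma herm_fun_const: "hermitian M \<Longrightarrow> herm_fun (\<lambda>x. c) M = c *\<^sub>R mat 1"
  by (erule hermitian_diagonalizable)
    (simp add: herm_fun_diag comp_def real_diag_const matrix_scalar_ac unitary_matrixD
      flip: scalar_matrix_assoc)

lemma herm_fun_add:
  assumes "hermitian M"
  shows "herm_fun (\<lambda>x. f x + g x) M = herm_fun f M + herm_fun g M"
proof -
  obtain U d where U: "unitary_matrix U" "M = U ** real_diag d ** hconj U"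
    using assms by (rule hermitian_diagonalizable)
  have "real_diag (\<lambda>i. f (d i) + g (d i)) = real_diag (\<lambda>i. f (d i)) + real_diag (\<lambda>i. g (d i))"
    by (simp add: vec_eq_iff real_diag_nth)
  then show ?thesis
    using U by (simp add: herm_fun_diag comp_def matrix_add_ldistrib matrix_add_rdistrib)
qed

lemma herm_fun_mult:
  assumes "hermitian M"
  shows "herm_fun (\<lambda>x. f x * g x) M = herm_fun f M ** herm_fun g M"
proof -
  obtain U d where U: "unitary_matrix U" "M = U ** real_diag d ** hconj U"
    using assms by (rule hermitian_diagonalizable)
  have "herm_fun f M ** herm_fun g M
      = U ** (real_diag (f \<circ> d) ** real_diag (g \<circ> d)) ** hconj U"
    using U by (simp add: herm_fun_diag matrix_mul_assoc unitary_matrixD)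
  also have "\<dots> = herm_fun (\<lambda>x. f x * g x) M"
    using U by (simp add: herm_fun_diag comp_def real_diag_mult)
  finally show ?thesis ..
qed

lemma herm_fun_cmult:
  "hermitian M \<Longrightarrow> herm_fun (\<lambda>x. c * f x) M = c *\<^sub>R herm_fun f M"
  by (simp add: herm_fun_mult herm_fun_const flip: scalar_matrix_assoc)

lemma herm_fun_comp:
  assumes "hermitian M"
  shows "herm_fun f (herm_fun g M) = herm_fun (\<lambda>x. f (g x)) M"
proof -
  obtain U d where "unitary_matrix U" "M = U ** real_diag d ** hconj U"
    using assms by (rule hermitian_diagonalizable)
  then show ?thesis by (simp add: herm_fun_diag comp_def)
qed

lemma herm_fun_cong:
  assumes "posdef M" "\<And>x. 0 < x \<Longrightarrow> f x = g x"
  shows "herm_fun f M = herm_fun g M"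
proof -
  obtain U d where U: "unitary_matrix U" "M = U ** real_diag d ** hconj U" "\<forall>i. 0 < d i"
    using assms(1) by (rule posdef_diagonalizable)
  have "f \<circ> d = g \<circ> d" using U(3) assms(2) by auto
  then show ?thesis using U(1,2) by (simp add: herm_fun_diag)
qed

lemma posdef_herm_fun:
  assumes "posdef M" "\<And>x. 0 < x \<Longrightarrow> 0 < f x"
  shows "posdef (herm_fun f M)"
proof -
  obtain U d where U: "unitary_matrix U" "M = U ** real_diag d ** hconj U" "\<forall>i. 0 < d i"
    using assms(1) by (rule posdef_diagonalizable)
  then show ?thesis using assms(2) by (simp add: herm_fun_diag posdef_diag)
qed

lemma unitary_mult: "unitary_matrix U \<Longrightarrow> unitary_matrix V \<Longrightarrow> unitary_matrix (U ** V)"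
  by (simp add: unitary_matrix_def hconj_mult) (metis matrix_mul_assoc matrix_mul_rid)

lemma unitary_hconj: "unitary_matrix U \<Longrightarrow> unitary_matrix (hconj U)"
  by (simp add: unitary_matrix_def)

lemma herm_fun_unitary_conj:
  assumes "hermitian M" and V: "unitary_matrix V"
  shows "herm_fun f (hconj V ** M ** V) = hconj V ** herm_fun f M ** V"
proof -
  obtain U d where U: "unitary_matrix U" "M = U ** real_diag d ** hconj U"
    using assms(1) by (rule hermitian_diagonalizable)
  have "hconj V ** (U ** real_diag e ** hconj U) ** V
      = (hconj V ** U) ** real_diag e ** hconj (hconj V ** U)" for e
    by (simp add: hconj_mult matrix_mul_assoc)
  then show ?thesis
    using U by (simp add: herm_fun_diag unitary_mult unitary_hconj V)
qed

lemma posdef_inverse: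
  assumes "posdef M"
  shows "invertible M" "matrix_inv M = herm_fun inverse M"
proof -
  have H: "hermitian M" using assms by (simp add: posdef_def)
  have "M ** herm_fun inverse M = herm_fun (\<lambda>x. x * inverse x) M"
    by (simp add: herm_fun_mult herm_fun_id H)
  also have "\<dots> = herm_fun (\<lambda>x. 1) M"
    using assms by (rule herm_fun_cong) simp
  finally have 1: "M ** herm_fun inverse M = mat 1" by (simp add: herm_fun_const H)
  then show "invertible M" by (auto simp: invertible_right_inverse)
  show "matrix_inv M = herm_fun inverse M" using 1 by (rule matrix_inv_eqI)
qed

lemma posdef_matrix_inv: "posdef M \<Longrightarrow> posdef (matrix_inv M)"
  by (simp add: posdef_inverse posdef_herm_fun)

lemma posdef_congruence:
  fixes M C :: "complex^'n^'n"
  assumes M: "posdef M" and C: "invertible C"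
  shows "posdef (hconj C ** M ** C)"
proof -
  have "hermitian (hconj C ** M ** C)"
    using M by (simp add: posdef_def hermitian_def hconj_mult matrix_mul_assoc)
  moreover have "0 < Re (hform (hconj C ** M ** C) v)" if "v \<noteq> 0" for v
  proof -
    have "matrix_inv C *v (C *v v) = v"
      by (simp add: matrix_vector_mul_assoc matrix_inv_cancel C)
    then have "C *v v \<noteq> 0"
      using that by (metis matrix_vector_mult_0_right)
    moreover have "Re (hform (hconj C ** M ** C) v) = Re (hform M (C *v v))"
      by (simp add: Re_hform inner_matrix_vector flip: matrix_vector_mul_assoc)
    ultimately show ?thesis using M by (simp add: posdef_def)
  qed
  ultimately show ?thesis by (simp add: posdef_def)
qed

lemma trace_unitary_conj:
  "unitary_matrix U \<Longrightarrow> trace (hconj U ** X ** U) = trace X"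
  by (subst trace_mul_sym) (simp add: matrix_mul_assoc unitary_matrixD)

lemma trace_real_diag: "trace (real_diag d) = complex_of_real (\<Sum>i\<in>UNIV. d i)"
  by (simp add: trace_def real_diag_nth)

text \<open>Through determinants, the trace of the logarithm splits over products of matrices that do not
  commute.\<close>

lemma trace_mlog:
  assumes "posdef M"
  shows "Re (trace (mlog M)) = ln (cmod (det M))" "det M \<noteq> 0"
proof -
  obtain U d where U: "unitary_matrix U" and M: "M = U ** real_diag d ** hconj U"
    and d: "\<forall>i. 0 < d i"
    using assms by (rule posdef_diagonalizable)
  have 1: "det U * det (hconj U) = 1"
    by (simp add: unitary_matrixD(1)[OF U] flip: det_mul)
  have "det M = det (real_diag d) * (det U * det (hconj U))"
    by (simp add: M det_mul mult_ac)
  also have "\<dots> = (\<Prod>i\<in>UNIV. complex_of_real (d i))"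
    unfolding 1 by (subst det_diagonal) (auto simp: real_diag_nth)
  finally have det: "det M = complex_of_real (\<Prod>i\<in>UNIV. d i)" by simp
  have pos: "(\<Prod>i\<in>UNIV. d i) > 0" using d by (simp add: prod_pos)
  show "det M \<noteq> 0" unfolding det of_real_eq_0_iff using pos by linarith
  have "trace (mlog M) = trace (real_diag (ln \<circ> d))"
    unfolding mlog_def M herm_fun_diag[OF U]
    using trace_unitary_conj[OF unitary_hconj[OF U]] by simp
  also have "\<dots> = complex_of_real (\<Sum>i\<in>UNIV. ln (d i))" by (simp add: trace_real_diag)
  also have "(\<Sum>i\<in>UNIV. ln (d i)) = ln (\<Prod>i\<in>UNIV. d i)"
    using d by (intro ln_prod[symmetric]) (auto simp: less_imp_neq[THEN not_sym])
  finally show "Re (trace (mlog M)) = ln (cmod (det M))"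
    using det pos by (simp add: norm_of_real del: of_real_prod)
qed

text \<open>With \<open>a\<^sub>i\<close>, \<open>b\<^sub>j\<close> the eigenvalues of the two matrices and \<open>p\<^sub>i\<^sub>j\<close> the overlaps of their eigenvectors, the
  right-hand side minus the left-hand side is
  \<open>\<Sum>\<^sub>i\<^sub>j \<bar>p\<^sub>i\<^sub>j\<bar>\<^sup>2 (f a\<^sub>i - f b\<^sub>j - (a\<^sub>i - b\<^sub>j) g b\<^sub>j)\<close>, a sum of nonnegative terms. If it vanishes, then
  nonzero overlaps occur between equal eigenvalues only, so that the matrices agree.\<close>

lemma klein_inequality:
  assumes A: "posdef A" and B: "posdef B"
    and tangent: "\<And>a b. 0 < a \<Longrightarrow> 0 < b \<Longrightarrow> a \<noteq> b \<Longrightarrow> f b + (a - b) * g b < f a"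
  shows "Re (trace (herm_fun f B)) + Re (trace ((A - B) ** herm_fun g B)) \<le> Re (trace (herm_fun f A))"
    and "Re (trace (herm_fun f B)) + Re (trace ((A - B) ** herm_fun g B)) = Re (trace (herm_fun f A))
      \<Longrightarrow> A = B"
proof -
  obtain U a where U: "unitary_matrix U" and A': "A = U ** real_diag a ** hconj U" and a: "\<forall>i. 0 < a i"
    using A by (rule posdef_diagonalizable)
  obtain V b where V: "unitary_matrix V" and B': "B = V ** real_diag b ** hconj V" and b: "\<forall>i. 0 < b i"
    using B by (rule posdef_diagonalizable)
  define P where "P = hconj U ** V"
  have P: "unitary_matrix P" unfolding P_def by (intro unitary_mult unitary_hconj U V)
  define q where "q i j = (cmod (P $ i $ j))\<^sup>2" for i j
  have row: "(\<Sum>j\<in>UNIV. q i j) = 1" for i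
  proof -
    have "(P ** hconj P) $ i $ i = 1" by (simp add: unitary_matrixD[OF P] mat_def)
    then have "complex_of_real (\<Sum>j\<in>UNIV. q i j) = 1"
      by (simp add: matrix_matrix_mult_def q_def complex_mult_cnj cmod_power2)
    then show ?thesis using of_real_eq_1_iff by blast
  qed
  have col: "(\<Sum>i\<in>UNIV. q i j) = 1" for j
  proof -
    have "(hconj P ** P) $ j $ j = 1" by (simp add: unitary_matrixD[OF P] mat_def)
    then have "complex_of_real (\<Sum>i\<in>UNIV. q i j) = 1"
      by (simp add: matrix_matrix_mult_def q_def complex_mult_cnj cmod_power2 mult.commute)
    then show ?thesis using of_real_eq_1_iff by blast
  qed
  have tr_diag: "Re (trace (S ** real_diag c ** hconj S)) = (\<Sum>i\<in>UNIV. c i)"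
    if "unitary_matrix S" for S :: "complex^'a^'a" and c
    using trace_unitary_conj[OF unitary_hconj[OF that], of "real_diag c"] by (simp add: trace_real_diag)
  have fA: "Re (trace (herm_fun f A)) = (\<Sum>i\<in>UNIV. \<Sum>j\<in>UNIV. q i j * f (a i))"
    unfolding A' herm_fun_diag[OF U] by (simp add: tr_diag U row flip: sum_distrib_right)
  have "(\<Sum>i\<in>UNIV. \<Sum>j\<in>UNIV. q i j * h j) = (\<Sum>j\<in>UNIV. h j)" for h :: "'a \<Rightarrow> real"
    by (subst sum.swap) (simp add: col flip: sum_distrib_right)
  note sum_col = this
  have fB: "Re (trace (herm_fun f B)) = (\<Sum>i\<in>UNIV. \<Sum>j\<in>UNIV. q i j * f (b j))"
    unfolding B' herm_fun_diag[OF V] by (simp add: tr_diag V sum_col)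
  have BgB: "Re (trace (B ** herm_fun g B)) = (\<Sum>i\<in>UNIV. \<Sum>j\<in>UNIV. q i j * (b j * g (b j)))"
  proof -
    have "B ** herm_fun g B = herm_fun (\<lambda>x. x * g x) B"
      using B by (simp add: herm_fun_mult herm_fun_id posdef_imp_hermitian)
    then show ?thesis unfolding sum_col unfolding B' herm_fun_diag[OF V] by (simp add: tr_diag V)
  qed
  have AgB: "Re (trace (A ** herm_fun g B)) = (\<Sum>i\<in>UNIV. \<Sum>j\<in>UNIV. q i j * (a i * g (b j)))"
  proof -
    have "trace (A ** herm_fun g B)
        = trace (U ** (real_diag a ** P ** real_diag (g \<circ> b) ** hconj V))"
      unfolding A' unfolding B' herm_fun_diag[OF V] by (simp add: P_def matrix_mul_assoc)
    also have "\<dots> = trace (real_diag a ** P ** real_diag (g \<circ> b) ** hconj P)"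
      by (subst trace_mul_sym) (simp add: P_def hconj_mult matrix_mul_assoc)
    also have "\<dots> = (\<Sum>i\<in>UNIV. \<Sum>j\<in>UNIV. complex_of_real (q i j * (a i * g (b j))))"
    proof -
      have "(real_diag a ** P ** real_diag (g \<circ> b) ** hconj P) $ i $ i
         = (\<Sum>j\<in>UNIV. complex_of_real (q i j * (a i * g (b j))))" for i
      proof -
        have "P $ i $ j * cnj (P $ i $ j) = complex_of_real (q i j)" for j
          by (simp add: q_def complex_mult_cnj cmod_power2)
        then have *: "complex_of_real (a i) * P $ i $ j * complex_of_real (g (b j)) * cnj (P $ i $ j)
            = complex_of_real (q i j * (a i * g (b j)))" for j
          by (simp add: mult_ac)
        show ?thesis
          by (subst matrix_matrix_mult_def) (simp add: mult_real_diag_nth real_diag_mult_nth * del: of_real_mult)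
      qed
      then show ?thesis unfolding trace_def by simp
    qed
    finally show ?thesis by simp
  qed
  define \<delta> where "\<delta> i j = q i j * (f (a i) - f (b j) - (a i - b j) * g (b j))" for i j
  have \<delta>: "0 \<le> \<delta> i j" for i j
    unfolding \<delta>_def q_def using tangent[OF a[rule_format] b[rule_format], of i j]
    by (cases "a i = b j") (auto intro!: mult_nonneg_nonneg)
  have gap: "Re (trace (herm_fun f A)) - (Re (trace (herm_fun f B)) + Re (trace ((A - B) ** herm_fun g B)))
      = (\<Sum>i\<in>UNIV. \<Sum>j\<in>UNIV. \<delta> i j)"
  proof -
    have "Re (trace ((A - B) ** herm_fun g B))
        = Re (trace (A ** herm_fun g B)) - Re (trace (B ** herm_fun g B))"
      by (simp add: matrix_diff_rdistrib trace_sub)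
    then show ?thesis
      unfolding \<delta>_def fA fB AgB BgB by (simp add: algebra_simps sum_subtractf sum.distrib)
  qed
  moreover have "0 \<le> (\<Sum>i\<in>UNIV. \<Sum>j\<in>UNIV. \<delta> i j)" by (intro sum_nonneg \<delta>)
  ultimately show "Re (trace (herm_fun f B)) + Re (trace ((A - B) ** herm_fun g B)) \<le> Re (trace (herm_fun f A))"
    by linarith
  assume "Re (trace (herm_fun f B)) + Re (trace ((A - B) ** herm_fun g B)) = Re (trace (herm_fun f A))"
  then have "(\<Sum>i\<in>UNIV. \<Sum>j\<in>UNIV. \<delta> i j) = 0" using gap by simp
  then have "\<delta> i j = 0" for i j
    using \<delta> by (simp add: sum_nonneg_eq_0_iff sum_nonneg)
  then have "P $ i $ j = 0 \<or> a i = b j" for i j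
    using tangent[OF a[rule_format] b[rule_format], of i j] unfolding \<delta>_def q_def by (smt (verit) mult_eq_0_iff norm_eq_zero power2_eq_square)
  then have "real_diag a ** P = P ** real_diag b"
    by (simp add: vec_eq_iff mult_real_diag_nth real_diag_mult_nth)
  then have "U ** (real_diag a ** P) ** hconj V = U ** (P ** real_diag b) ** hconj V" by simp
  then show "A = B"
    by (simp add: A' B' P_def matrix_mul_assoc unitary_matrixD[OF U] unitary_matrixD[OF V])
qed

section \<open>Bounded measurable matrix functions on the circle\<close>

lemma bounded_bilinear_matrix_mult:
  "bounded_bilinear ((**) :: complex^'b^'a \<Rightarrow> complex^'c^'b \<Rightarrow> complex^'c^'a)"
  unfolding bilinear_conv_bounded_bilinear[symmetric] bilinear_def
  by (auto intro!: linearI simp: matrix_add_ldistrib matrix_add_rdistrib matrix_scalar_ac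
      simp flip: scalar_matrix_assoc)

lemma bounded_linear_hconj: "bounded_linear (hconj :: complex^'b^'a \<Rightarrow> complex^'a^'b)"
  unfolding linear_conv_bounded_linear[symmetric] by (intro linearI hconj_add hconj_scaleR)

lemma bounded_linear_trace: "bounded_linear (trace :: complex^'a^'a \<Rightarrow> complex)"
  unfolding linear_conv_bounded_linear[symmetric]
  by (intro linearI) (simp_all add: trace_def sum.distrib scaleR_sum_right)

lemma bounded_linear_Re_trace: "bounded_linear (\<lambda>M :: complex^'a^'a. Re (trace M))"
  using bounded_linear_compose[OF bounded_linear_Re bounded_linear_trace] .

lemma norm_hconj_trace: "(norm M)\<^sup>2 = Re (trace (M ** hconj M))"
  by (simp add: power2_norm_eq_inner inner_vec_def trace_def matrix_matrix_mult_def inner_complex_def)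

lemma norm_unitary_conj:
  assumes U: "unitary_matrix U"
  shows "norm (U ** X ** hconj U) = norm X"
proof -
  have "(norm (U ** X ** hconj U))\<^sup>2 = Re (trace (U ** (X ** hconj X) ** hconj U))"
    by (simp add: norm_hconj_trace hconj_mult matrix_mul_assoc unitary_matrixD[OF U])
  also have "\<dots> = (norm X)\<^sup>2"
    using trace_unitary_conj[OF unitary_hconj[OF U]] by (simp add: norm_hconj_trace)
  finally show ?thesis by simp
qed

lemma norm_real_diag: "(norm (real_diag d))\<^sup>2 = (\<Sum>i\<in>UNIV. (d i)\<^sup>2)"
  unfolding norm_hconj_trace by (simp add: real_diag_mult trace_real_diag power2_eq_square)

text \<open>Bounded measurable functions on the circle form an algebra and are integrable, which is why
  they are used as the ambient class for all integrands.\<close>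

definition circle_bdd :: "(complex \<Rightarrow> complex^'a^'b) \<Rightarrow> bool" where
  "circle_bdd F \<longleftrightarrow> circle_measurable F \<and> bounded (F ` unit_circle)"

lemma circle_bdd_cong:
  assumes "\<And>z. z \<in> unit_circle \<Longrightarrow> F z = H z"
  shows "circle_bdd F \<longleftrightarrow> circle_bdd H"
proof -
  have "(\<lambda>t. F (cis t)) = (\<lambda>t. H (cis t))" using assms by simp
  moreover have "F ` unit_circle = H ` unit_circle" using assms by (intro image_cong) auto
  ultimately show ?thesis by (simp add: circle_bdd_def circle_measurable_def)
qed

lemma circle_bdd_eqI:
  "circle_bdd H \<Longrightarrow> (\<And>z. z \<in> unit_circle \<Longrightarrow> F z = H z) \<Longrightarrow> circle_bdd F"
  using circle_bdd_cong[of F H] by blast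

lemma continuous_on_cis_comp:
  assumes "continuous_on unit_circle F"
  shows "continuous_on UNIV (\<lambda>t. F (cis t))"
  by (rule continuous_on_compose2[OF assms]) (auto intro!: continuous_intros)

lemma circle_bdd_continuous:
  assumes "continuous_on unit_circle F"
  shows "circle_bdd F"
  using continuous_on_cis_comp[OF assms] compact_continuous_image[OF assms compact_sphere]
  by (auto simp: circle_bdd_def circle_measurable_def intro: borel_measurable_continuous_onI compact_imp_bounded)

lemma circle_bdd_bilinear:
  fixes F :: "complex \<Rightarrow> complex^'a^'b" and H :: "complex \<Rightarrow> complex^'c^'d"
    and h :: "complex^'a^'b \<Rightarrow> complex^'c^'d \<Rightarrow> complex^'e^'f"
  assumes h: "bounded_bilinear h" and F: "circle_bdd F" and H: "circle_bdd H"
  shows "circle_bdd (\<lambda>z. h (F z) (H z))"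
proof -
  interpret bounded_bilinear h by (rule h)
  have "continuous_on UNIV (\<lambda>x. h (fst x) (snd x))"
    by (intro continuous_on continuous_on_fst continuous_on_snd continuous_on_id)
  then have "circle_measurable (\<lambda>z. h (F z) (H z))"
    using F H unfolding circle_bdd_def circle_measurable_def
    by (elim conjE) (rule borel_measurable_continuous_Pair)
  moreover
  obtain b c where "\<forall>z\<in>unit_circle. norm (F z) \<le> b" "\<forall>z\<in>unit_circle. norm (H z) \<le> c"
    using F H unfolding circle_bdd_def bounded_iff by fast
  moreover obtain K where K: "\<And>x y. norm (h x y) \<le> norm x * norm y * K" "K > 0"
    using pos_bounded by blast
  ultimately have "\<forall>z\<in>unit_circle. norm (h (F z) (H z)) \<le> b * c * K"
    by (meson mult_mono mult_right_mono norm_ge_zero order_trans less_imp_le)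
  then have "bounded ((\<lambda>z. h (F z) (H z)) ` unit_circle)" unfolding bounded_iff by blast
  with \<open>circle_measurable _\<close> show ?thesis by (simp add: circle_bdd_def)
qed

lemma circle_bdd_linear:
  fixes F :: "complex \<Rightarrow> complex^'a^'b" and h :: "complex^'a^'b \<Rightarrow> complex^'c^'d"
  assumes h: "bounded_linear h" and F: "circle_bdd F"
  shows "circle_bdd (\<lambda>z. h (F z))"
  using F bounded_linear_image[OF _ h, of "F ` unit_circle"]
  by (auto simp: circle_bdd_def circle_measurable_def image_image
      intro: borel_measurable_continuous_on[OF linear_continuous_on[OF h]])

lemmas circle_bdd_mult = circle_bdd_bilinear[OF bounded_bilinear_matrix_mult]
lemmas circle_bdd_hconj = circle_bdd_linear[OF bounded_linear_hconj]
lemmas circle_bdd_scaleR = circle_bdd_linear[OF bounded_linear_scaleR_right]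

lemma circle_bdd_const: "circle_bdd (\<lambda>z. C)"
  by (intro circle_bdd_continuous continuous_intros)

lemma circle_bdd_add:
  fixes F H :: "complex \<Rightarrow> complex^'a^'b"
  assumes "circle_bdd F" "circle_bdd H"
  shows "circle_bdd (\<lambda>z. F z + H z)"
  using assms bounded_plus_comp[of F unit_circle H]
  by (auto simp: circle_bdd_def circle_measurable_def)

lemma circle_bdd_diff:
  fixes F H :: "complex \<Rightarrow> complex^'a^'b"
  assumes "circle_bdd F" "circle_bdd H"
  shows "circle_bdd (\<lambda>z. F z - H z)"
  using assms bounded_minus_comp[of F unit_circle H]
  by (auto simp: circle_bdd_def circle_measurable_def)

lemmas circle_bdd_intros = circle_bdd_mult circle_bdd_hconj circle_bdd_scaleR circle_bdd_const
  circle_bdd_add circle_bdd_diff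

text \<open>A factor inherits the bound of the product, as \<open>\<parallel>F\<parallel>\<^sup>2 = tr (F F\<^sup>*)\<close>; this is how measurable spectral
  factors of a bounded density turn out to be bounded.\<close>

lemma circle_bdd_factor:
  assumes F: "circle_measurable F" and FF: "circle_bdd (\<lambda>z. F z ** hconj (F z))"
  shows "circle_bdd F"
proof -
  obtain b where b: "\<forall>z\<in>unit_circle. \<bar>Re (trace (F z ** hconj (F z)))\<bar> \<le> b"
    using FF bounded_linear_image[OF _ bounded_linear_Re_trace, of "(\<lambda>z. F z ** hconj (F z)) ` unit_circle"]
    unfolding circle_bdd_def by (auto simp: image_image bounded_iff)
  have "norm (F z) \<le> sqrt b" if "z \<in> unit_circle" for z
    using b that by (intro real_le_rsqrt) (auto simp: norm_hconj_trace intro: abs_le_D1)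
  then show ?thesis using F unfolding circle_bdd_def bounded_iff by blast
qed

text \<open>Pointwise positive definite with bounds on the function and on its inverse. For a measurable
  function these bounds amount to \<open>a I \<preceq> M \<preceq> b I\<close> with \<open>0 < a\<close>.\<close>

definition coercive :: "(complex \<Rightarrow> complex^'m^'m) \<Rightarrow> bool" where
  "coercive M \<longleftrightarrow> circle_bdd M \<and> circle_bdd (\<lambda>z. matrix_inv (M z)) \<and> (\<forall>z\<in>unit_circle. posdef (M z))"

lemma coercive_cong:
  assumes "\<And>z. z \<in> unit_circle \<Longrightarrow> F z = H z"
  shows "coercive F \<longleftrightarrow> coercive H"
  using circle_bdd_cong[of F H] circle_bdd_cong[of "\<lambda>z. matrix_inv (F z)" "\<lambda>z. matrix_inv (H z)"] assms
  by (auto simp: coercive_def)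

text \<open>The Frobenius norm is unitarily invariant and dominates every eigenvalue, so that the bound on
  the inverse keeps the eigenvalues away from zero.\<close>

lemma coercive_spectrum:
  assumes "coercive M"
  obtains a b where "0 < a" "0 < b"
    "\<And>z U d i. z \<in> unit_circle \<Longrightarrow> unitary_matrix U \<Longrightarrow> M z = U ** real_diag d ** hconj U \<Longrightarrow>
      d i \<in> {a..b}"
proof -
  obtain b where b: "b > 0" "\<And>z. z \<in> unit_circle \<Longrightarrow> norm (M z) \<le> b"
    using assms unfolding coercive_def circle_bdd_def bounded_pos by auto
  obtain c where c: "c > 0" "\<And>z. z \<in> unit_circle \<Longrightarrow> norm (matrix_inv (M z)) \<le> c"
    using assms unfolding coercive_def circle_bdd_def bounded_pos by auto
  have entry: "\<bar>d i\<bar> \<le> norm (U ** real_diag d ** hconj U)" if "unitary_matrix U"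
    for U and d :: "'a \<Rightarrow> real" and i
  proof -
    have "(d i)\<^sup>2 \<le> (\<Sum>i\<in>UNIV. (d i)\<^sup>2)" by (intro member_le_sum) auto
    then show ?thesis
      using norm_unitary_conj[OF that, of "real_diag d"] norm_real_diag[of d]
      by (metis abs_le_square_iff abs_norm_cancel)
  qed
  have "d i \<in> {1/c..b}" if z: "z \<in> unit_circle" and U: "unitary_matrix U"
    and M: "M z = U ** real_diag d ** hconj U" for z U d i
  proof -
    have pd: "posdef (M z)" using assms z by (simp add: coercive_def)
    then have d: "d i > 0" using posdef_diag[OF U] M by metis
    have "\<bar>inverse (d i)\<bar> \<le> norm (matrix_inv (M z))"
      using entry[OF U, of "inverse \<circ> d" i] by (simp add: posdef_inverse[OF pd]) (simp add: M herm_fun_diag U)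
    then have "inverse (d i) \<le> c" using c(2)[OF z] d by simp
    then have "1 / c \<le> d i" using d c(1) by (simp add: field_simps)
    moreover have "d i \<le> b" using entry[OF U, of d i] b(2)[OF z] M d by simp
    ultimately show ?thesis by simp
  qed
  then show thesis using that[of "1/c" b] b c by simp
qed

lemma circle_bdd_herm_fun_polynomial:
  assumes "real_polynomial_function p" and M: "circle_bdd M" "\<And>z. z \<in> unit_circle \<Longrightarrow> hermitian (M z)"
  shows "circle_bdd (\<lambda>z. herm_fun p (M z))"
  using assms(1)
proof induction
  case (linear f)
  then have "f x = f 1 * x" for x by (metis mult.right_neutral mult.commute real_scaleR_def linear_simps(5))
  then have f: "f = (\<lambda>x. f 1 * x)" by blast
  have "herm_fun f (M z) = f 1 *\<^sub>R M z" if "z \<in> unit_circle" for z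
    by (subst f) (simp only: herm_fun_cmult[where f = "\<lambda>x. x"] herm_fun_id M(2) that)
  then show ?case by (rule circle_bdd_eqI[OF circle_bdd_scaleR[OF M(1)]])
next
  case (const c)
  have "herm_fun (\<lambda>x. c) (M z) = c *\<^sub>R mat 1" if "z \<in> unit_circle" for z
    by (rule herm_fun_const[OF M(2)[OF that]])
  then show ?case by (rule circle_bdd_eqI[OF circle_bdd_const])
next
  case (add f g)
  have "herm_fun (\<lambda>x. f x + g x) (M z) = herm_fun f (M z) + herm_fun g (M z)" if "z \<in> unit_circle" for z
    by (rule herm_fun_add[OF M(2)[OF that]])
  then show ?case by (rule circle_bdd_eqI[OF circle_bdd_add[OF add.IH]])
next
  case (mult f g)
  have "herm_fun (\<lambda>x. f x * g x) (M z) = herm_fun f (M z) ** herm_fun g (M z)" if "z \<in> unit_circle" for z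
    by (rule herm_fun_mult[OF M(2)[OF that]])
  then show ?case by (rule circle_bdd_eqI[OF circle_bdd_mult[OF mult.IH]])
qed

text \<open>The functional calculus is defined by a separate diagonalization at each point, which says
  nothing about measurability. That comes from uniform polynomial approximation of \<open>f\<close> on an interval
  that contains the whole spectrum, because a polynomial of a measurable matrix function is measurable.\<close>

lemma circle_bdd_herm_fun:
  fixes M :: "complex \<Rightarrow> complex^'m^'m"
  assumes M: "coercive M" and f: "continuous_on {0<..} f"
  shows "circle_bdd (\<lambda>z. herm_fun f (M z))"
proof -
  have herm: "hermitian (M z)" if "z \<in> unit_circle" for z
    using M that by (simp add: coercive_def posdef_def)
  obtain a b where a: "0 < a" and ab: "\<And>z U d i. z \<in> unit_circle \<Longrightarrow> unitary_matrix U \<Longrightarrow>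
      M z = U ** real_diag d ** hconj U \<Longrightarrow> d i \<in> {a..b}"
    using coercive_spectrum[OF M] by metis
  have fab: "continuous_on {a..b} f" using f a by (auto intro: continuous_on_subset)
  have "\<exists>p. real_polynomial_function p \<and> (\<forall>x\<in>{a..b}. \<bar>f x - p x\<bar> < inverse (real (Suc n)))" for n
    using Stone_Weierstrass_real_polynomial_function[OF compact_Icc fab, of "inverse (real (Suc n))"]
    by (metis inverse_positive_iff_positive of_nat_0_less_iff zero_less_Suc)
  then obtain p where p: "\<And>n. real_polynomial_function (p n)"
    and approx: "\<And>n x. x \<in> {a..b} \<Longrightarrow> \<bar>f x - p n x\<bar> < inverse (real (Suc n))"
    by metis
  have lim_p: "(\<lambda>n. p n x) \<longlonglongrightarrow> f x" if "x \<in> {a..b}" for x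
  proof (rule LIMSEQ_I)
    fix e :: real assume "e > 0"
    then obtain N where "inverse (real (Suc N)) < e" using reals_Archimedean by blast
    moreover have "norm (p n x - f x) < inverse (real (Suc N))" if "n \<ge> N" for n
    proof -
      have "norm (p n x - f x) < inverse (real (Suc n))"
        using approx[OF \<open>x \<in> {a..b}\<close>, of n] by (simp add: abs_minus_commute)
      also have "\<dots> \<le> inverse (real (Suc N))" using that by (intro le_imp_inverse_le) auto
      finally show ?thesis .
    qed
    ultimately show "\<exists>N. \<forall>n\<ge>N. norm (p n x - f x) < e" by (meson order_less_trans)
  qed
  have lim: "(\<lambda>n. herm_fun (p n) (M z)) \<longlonglongrightarrow> herm_fun f (M z)" if z: "z \<in> unit_circle" for z
  proof -
    obtain U d where U: "unitary_matrix U" and Mz: "M z = U ** real_diag d ** hconj U"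
      using herm[OF z] by (rule hermitian_diagonalizable)
    have "(\<lambda>n. real_diag (p n \<circ> d)) \<longlonglongrightarrow> real_diag (f \<circ> d)"
      using lim_p ab[OF z U Mz]
      by (intro vec_tendstoI) (auto simp: real_diag_nth intro!: tendsto_intros)
    then have "(\<lambda>n. U ** real_diag (p n \<circ> d) ** hconj U) \<longlonglongrightarrow> U ** real_diag (f \<circ> d) ** hconj U"
      by (intro bounded_bilinear.tendsto[OF bounded_bilinear_matrix_mult] tendsto_const)
    then show ?thesis by (simp add: Mz herm_fun_diag[OF U])
  qed
  have "circle_measurable (\<lambda>z. herm_fun f (M z))"
    unfolding circle_measurable_def
  proof (rule borel_measurable_LIMSEQ_metric[where f = "\<lambda>n t. herm_fun (p n) (M (cis t))"])
    show "(\<lambda>t. herm_fun (p n) (M (cis t))) \<in> borel_measurable lborel" for n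
    proof -
      have "circle_bdd M" using M by (simp add: coercive_def)
      then have "circle_bdd (\<lambda>z. herm_fun (p n) (M z))"
        using herm by (rule circle_bdd_herm_fun_polynomial[OF p])
      then show ?thesis by (simp add: circle_bdd_def circle_measurable_def)
    qed
  qed (use lim in simp)
  moreover have "bounded ((\<lambda>z. herm_fun f (M z)) ` unit_circle)"
  proof -
    have "bounded (f ` {a..b})"
      using fab by (intro compact_imp_bounded compact_continuous_image) auto
    then obtain c where "\<forall>y\<in>f ` {a..b}. norm y \<le> c" unfolding bounded_iff by blast
    then have c: "\<bar>f x\<bar> \<le> c" if "x \<in> {a..b}" for x using that by force
    have "norm (herm_fun f (M z)) \<le> sqrt (real CARD('m) * c\<^sup>2)" if z: "z \<in> unit_circle" for z
    proof -
      obtain U d where U: "unitary_matrix U" and Mz: "M z = U ** real_diag d ** hconj U"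
        using herm[OF z] by (rule hermitian_diagonalizable)
      have "(f (d i))\<^sup>2 \<le> c\<^sup>2" for i
        using c[OF ab[OF z U Mz, of i]] by (metis abs_ge_zero power2_abs power_mono)
      then have "(\<Sum>i\<in>UNIV. ((f \<circ> d) i)\<^sup>2) \<le> real CARD('m) * c\<^sup>2"
        using sum_mono[of UNIV "\<lambda>i. ((f \<circ> d) i)\<^sup>2" "\<lambda>_. c\<^sup>2"] by simp
      then show ?thesis
        by (intro real_le_rsqrt) (simp add: Mz herm_fun_diag U norm_unitary_conj norm_real_diag)
    qed
    then show ?thesis unfolding bounded_iff by blast
  qed
  ultimately show ?thesis by (simp add: circle_bdd_def)
qed

lemma coercive_herm_fun:
  assumes M: "coercive M" and f: "continuous_on {0<..} f" "\<And>x. 0 < x \<Longrightarrow> 0 < f x"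
  shows "coercive (\<lambda>z. herm_fun f (M z))"
proof -
  have inv: "matrix_inv (herm_fun f (M z)) = herm_fun (\<lambda>x. inverse (f x)) (M z)" if "z \<in> unit_circle" for z
    using M that f(2) by (simp add: coercive_def posdef_inverse posdef_herm_fun herm_fun_comp posdef_imp_hermitian)
  have "circle_bdd (\<lambda>z. herm_fun (\<lambda>x. inverse (f x)) (M z))"
    using f by (intro circle_bdd_herm_fun[OF M] continuous_intros) force+
  then have "circle_bdd (\<lambda>z. matrix_inv (herm_fun f (M z)))"
    by (rule circle_bdd_eqI) (rule inv)
  then show ?thesis
    using M f circle_bdd_herm_fun[OF M] by (simp add: coercive_def posdef_herm_fun)
qed

lemma coercive_congruence:
  fixes C D M :: "complex \<Rightarrow> complex^'m^'m"
  assumes M: "coercive M" and C: "circle_bdd C" and D: "circle_bdd D"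
    and CD: "\<And>z. z \<in> unit_circle \<Longrightarrow> C z ** D z = mat 1"
  shows "coercive (\<lambda>z. hconj (C z) ** M z ** C z)"
proof -
  have inv: "matrix_inv (hconj (C z) ** M z ** C z) = D z ** matrix_inv (M z) ** hconj (D z)"
    if z: "z \<in> unit_circle" for z
  proof (rule matrix_inv_eqI)
    have 1: "hconj (C z) ** hconj (D z) = mat 1"
      using matrix_mult_1_comm[OF CD[OF z]] by (metis hconj_mat_1 hconj_mult)
    have "invertible (M z)" using M z by (simp add: coercive_def posdef_inverse)
    note 2 = matrix_inv_cancel(1)[OF this]
    have "hconj (C z) ** M z ** C z ** (D z ** matrix_inv (M z) ** hconj (D z))
        = hconj (C z) ** (M z ** (C z ** D z) ** matrix_inv (M z)) ** hconj (D z)"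
      by (simp add: matrix_mul_assoc)
    also have "\<dots> = mat 1" by (simp add: CD[OF z] 1 2)
    finally show "hconj (C z) ** M z ** C z ** (D z ** matrix_inv (M z) ** hconj (D z)) = mat 1" .
  qed
  have "circle_bdd (\<lambda>z. D z ** matrix_inv (M z) ** hconj (D z))"
    using M D by (intro circle_bdd_intros) (auto simp: coercive_def)
  then have "circle_bdd (\<lambda>z. matrix_inv (hconj (C z) ** M z ** C z))"
    by (rule circle_bdd_eqI) (rule inv)
  moreover have "circle_bdd (\<lambda>z. hconj (C z) ** M z ** C z)"
    using M C by (intro circle_bdd_intros) (auto simp: coercive_def)
  moreover have "posdef (hconj (C z) ** M z ** C z)" if "z \<in> unit_circle" for z
    using M that CD[OF that] by (intro posdef_congruence) (auto simp: coercive_def invertible_right_inverse)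
  ultimately show ?thesis by (simp add: coercive_def)
qed

lemma continuous_on_det:
  fixes M :: "'x::topological_space \<Rightarrow> complex^'n^'n"
  assumes "continuous_on S M"
  shows "continuous_on S (\<lambda>z. det (M z))"
  unfolding det_def by (intro continuous_intros assms)

text \<open>Cramer's rule expresses the entries of the inverse as quotients of determinants.\<close>

lemma continuous_on_matrix_inv:
  fixes M :: "'x::topological_space \<Rightarrow> complex^'n^'n"
  assumes M: "continuous_on S M" and inv: "\<And>z. z \<in> S \<Longrightarrow> invertible (M z)"
  shows "continuous_on S (\<lambda>z. matrix_inv (M z))"
proof -
  define R where "R k j z = (\<chi> i l. if l = k then axis j 1 $ i else M z $ i $ l)" for k j z
  have det: "det (M z) \<noteq> 0" if "z \<in> S" for z using inv[OF that] by (simp add: invertible_det_nz)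
  have "matrix_inv (M z) $ k $ j = det (R k j z) / det (M z)" if "z \<in> S" for z k j
  proof -
    have "M z *v (matrix_inv (M z) *v axis j 1) = axis j 1"
      by (simp add: matrix_vector_mul_assoc matrix_inv_cancel inv[OF that])
    then have "matrix_inv (M z) *v axis j 1 = (\<chi> k. det (R k j z) / det (M z))"
      unfolding R_def using cramer[OF det[OF that]] by simp
    moreover have "(matrix_inv (M z) *v axis j 1) $ k = matrix_inv (M z) $ k $ j"
      by (simp add: matrix_vector_mult_def axis_def if_distrib[where f = "\<lambda>x. _ * x"] cong: if_cong)
    ultimately show ?thesis by simp
  qed
  then have eq: "matrix_inv (M z) = (\<chi> k j. det (R k j z) / det (M z))" if "z \<in> S" for z
    using that by (simp add: vec_eq_iff)
  have R: "continuous_on S (R k j)" for k j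
    unfolding R_def
  proof (intro continuous_on_vec_lambda)
    show "continuous_on S (\<lambda>z. if l = k then axis j 1 $ i else M z $ i $ l)" for i l
      by (cases "l = k") (auto intro!: continuous_intros M)
  qed
  have "continuous_on S (\<lambda>z. \<chi> k j. det (R k j z) / det (M z))"
    by (intro continuous_on_vec_lambda continuous_on_divide continuous_on_det R M) (use det in auto)
  then show ?thesis by (simp add: eq cong: continuous_on_cong)
qed

lemma coercive_continuous:
  assumes "continuous_on unit_circle M" "\<And>z. z \<in> unit_circle \<Longrightarrow> posdef (M z)"
  shows "coercive M"
  unfolding coercive_def
  by (intro conjI ballI circle_bdd_continuous continuous_on_matrix_inv posdef_inverse(1) assms)

lemmas continuous_on_matrix_mult = bounded_bilinear.continuous_on[OF bounded_bilinear_matrix_mult]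
lemmas continuous_on_hconj = bounded_linear.continuous_on[OF bounded_linear_hconj]

section \<open>Traces of integrals over the circle\<close>

lemma circle_bdd_integrable:
  fixes F :: "complex \<Rightarrow> complex^'a^'b"
  assumes "circle_bdd F"
  shows "set_integrable lborel {-pi..pi} (\<lambda>t. F (cis t))"
proof -
  obtain b where b: "\<And>z. z \<in> unit_circle \<Longrightarrow> norm (F z) \<le> b"
    using assms unfolding circle_bdd_def bounded_iff by blast
  show ?thesis
    unfolding set_integrable_def
  proof (rule integrableI_bounded_set_indicator[where B = b])
    show "(\<lambda>t. F (cis t)) \<in> borel_measurable lborel"
      using assms by (simp add: circle_bdd_def circle_measurable_def)
  qed (use b in \<open>auto simp: emeasure_lborel_Icc_eq\<close>)
qed

lemma Re_trace_circle_integral: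
  fixes F :: "complex \<Rightarrow> complex^'a^'b" and h :: "complex^'a^'b \<Rightarrow> real"
  assumes h: "bounded_linear h" and F: "circle_bdd F"
  shows "h (circle_integral F) = (1 / (2 * pi)) * (LINT t:{-pi..pi}|lborel. h (F (cis t)))"
    and "set_integrable lborel {-pi..pi} (\<lambda>t. h (F (cis t)))"
proof -
  interpret bounded_linear h by (rule h)
  have I: "integrable lborel (\<lambda>t. indicator {-pi..pi} t *\<^sub>R F (cis t))"
    using circle_bdd_integrable[OF F] by (simp add: set_integrable_def)
  show "h (circle_integral F) = (1 / (2 * pi)) * (LINT t:{-pi..pi}|lborel. h (F (cis t)))"
    using integral_bounded_linear[OF h I] by (simp add: circle_integral_def set_lebesgue_integral_def scaleR)
  show "set_integrable lborel {-pi..pi} (\<lambda>t. h (F (cis t)))"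
    using integrable_bounded_linear[OF h I] by (simp add: set_integrable_def scaleR)
qed

lemma tr_int_eq:
  assumes "circle_bdd F"
  shows "tr_int F = (1 / (2 * pi)) * (LINT t:{-pi..pi}|lborel. Re (trace (F (cis t))))"
  unfolding tr_int_def using Re_trace_circle_integral(1)[OF bounded_linear_Re_trace assms] .

lemma tr_int_cong:
  assumes "circle_bdd F" "circle_bdd H"
    and "\<And>z. z \<in> unit_circle \<Longrightarrow> Re (trace (F z)) = Re (trace (H z))"
  shows "tr_int F = tr_int H"
  using assms by (simp add: tr_int_eq)

lemma tr_int_add:
  assumes "circle_bdd F" "circle_bdd H"
  shows "tr_int (\<lambda>z. F z + H z) = tr_int F + tr_int H"
  using set_integral_add(2)[OF assms[THEN Re_trace_circle_integral(2)[OF bounded_linear_Re_trace]]]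
  by (simp add: tr_int_eq assms circle_bdd_add trace_add add_divide_distrib)

lemma tr_int_diff:
  assumes "circle_bdd F" "circle_bdd H"
  shows "tr_int (\<lambda>z. F z - H z) = tr_int F - tr_int H"
  using set_integral_diff(2)[OF assms[THEN Re_trace_circle_integral(2)[OF bounded_linear_Re_trace]]]
  by (simp add: tr_int_eq assms circle_bdd_diff trace_sub diff_divide_distrib)

lemma tr_int_scaleR:
  assumes "circle_bdd F"
  shows "tr_int (\<lambda>z. c *\<^sub>R F z) = c * tr_int F"
proof -
  have "Re (trace (c *\<^sub>R X)) = c * Re (trace X)" for X :: "complex^'a^'a"
    by (simp add: linear_simps(5)[OF bounded_linear_Re_trace])
  then show ?thesis using assms by (simp add: tr_int_eq circle_bdd_scaleR)
qed

lemma trace_circle_integral_mult: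
  fixes F :: "complex \<Rightarrow> complex^'a^'a"
  assumes F: "circle_bdd F"
  shows "Re (trace (circle_integral F ** C)) = tr_int (\<lambda>z. F z ** C)"
proof -
  have h: "bounded_linear (\<lambda>X :: complex^'a^'a. Re (trace (X ** C)))"
    using bounded_linear_compose[OF bounded_linear_Re_trace
        bounded_bilinear.bounded_linear_left[OF bounded_bilinear_matrix_mult, of C]] .
  show ?thesis
    using Re_trace_circle_integral(1)[OF h F] by (simp add: tr_int_eq circle_bdd_mult[OF F circle_bdd_const])
qed

lemma tr_int_nonpos_AE:
  assumes F: "circle_bdd F" and nn: "\<And>z. z \<in> unit_circle \<Longrightarrow> 0 \<le> Re (trace (F z))"
    and le: "tr_int F \<le> 0"
  shows "AE t in lborel. t \<in> {-pi..pi} \<longrightarrow> Re (trace (F (cis t))) = 0"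
proof -
  let ?g = "\<lambda>t. indicator {-pi..pi} t *\<^sub>R Re (trace (F (cis t)))"
  have I: "integrable lborel ?g"
    using Re_trace_circle_integral(2)[OF bounded_linear_Re_trace F] by (simp add: set_integrable_def)
  have nn': "AE t in lborel. 0 \<le> ?g t" using nn by (simp add: indicator_def)
  have "(LINT t|lborel. ?g t) \<le> 0"
    using le tr_int_eq[OF F] by (simp add: set_lebesgue_integral_def divide_le_0_iff pi_gt_zero[folded not_le])
  moreover have "0 \<le> (LINT t|lborel. ?g t)" using nn' by (rule integral_nonneg_AE)
  ultimately have "(LINT t|lborel. ?g t) = 0" by simp
  then have "AE t in lborel. ?g t = 0" using integral_nonneg_eq_0_iff_AE[OF I nn'] by blast
  then show ?thesis by eventually_elim (auto simp: indicator_def)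
qed

text \<open>A nonzero value of a continuous function persists on a nonempty open set of arguments, and such
  a set is not null. The endpoints \<open>t = \<plusminus> \<pi>\<close> are limits of interior points.\<close>

lemma continuous_circle_AE_zero:
  fixes F :: "complex \<Rightarrow> complex^'a^'b"
  assumes F: "continuous_on unit_circle F"
    and ae: "AE t in lborel. t \<in> {-pi..pi} \<longrightarrow> F (cis t) = 0" and z: "z \<in> unit_circle"
  shows "F z = 0"
proof (rule ccontr)
  assume "F z \<noteq> 0"
  define E where "E = {t. F (cis t) \<noteq> 0}"
  have E: "open E"
    unfolding E_def using continuous_on_cis_comp[OF F] by (intro open_Collect_neq continuous_intros)
  have "cis (Arg z) = z" using z by (metis cis_Arg_unique dist_0_norm mem_sphere norm_zero
        rcis_cmod_Arg rcis_def mult_1 of_real_1)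
  then have "Arg z \<in> E" using \<open>F z \<noteq> 0\<close> by (simp add: E_def)
  moreover have "Arg z \<in> closure {-pi<..<pi}"
    using Arg_bounded[of z] by (simp add: closure_greaterThanLessThan)
  ultimately have ne: "E \<inter> {-pi<..<pi} \<noteq> {}"
    using open_Int_closure_eq_empty[OF E, of "{-pi<..<pi}"] by blast
  have "\<not> negligible (E \<inter> {-pi<..<pi})"
    using E ne by (intro open_not_negligible) auto
  moreover have "E \<inter> {-pi<..<pi} \<in> null_sets lborel"
  proof -
    have "AE t in lborel. t \<notin> E \<inter> {-pi<..<pi}" using ae by eventually_elim (auto simp: E_def)
    moreover have "E \<inter> {-pi<..<pi} \<in> sets lborel" using E by auto
    ultimately show ?thesis using AE_iff_null_sets by blast
  qed
  ultimately show False
    using null_sets_completionI negligible_iff_null_sets by blast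
qed

section \<open>Entrywise conjugation\<close>

lemma map_cnj_mult: "map_matrix cnj (A ** B) = map_matrix cnj A ** map_matrix cnj B"
  by (simp add: vec_eq_iff matrix_matrix_mult_def)

lemma map_cnj_add: "map_matrix cnj (A + B) = map_matrix cnj A + map_matrix cnj B"
  by (simp add: vec_eq_iff)

lemma map_cnj_scaleR: "map_matrix cnj (c *\<^sub>R A) = c *\<^sub>R map_matrix cnj A"
  by (simp add: vec_eq_iff)

lemma map_cnj_hconj: "map_matrix cnj (hconj A) = hconj (map_matrix cnj A)"
  by (simp add: vec_eq_iff)

lemma map_cnj_cmat [simp]: "map_matrix cnj (cmat A) = cmat A"
  by (simp add: vec_eq_iff cmat_def)

lemma map_cnj_inverse:
  fixes A :: "complex^'n^'n"
  assumes "invertible A"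
  shows "map_matrix cnj (matrix_inv A) = matrix_inv (map_matrix cnj A)"
proof -
  have "map_matrix cnj A ** map_matrix cnj (matrix_inv A) = map_matrix cnj (mat 1)"
    by (simp add: matrix_inv_cancel assms flip: map_cnj_mult)
  also have "\<dots> = mat 1" by (simp add: vec_eq_iff mat_def)
  finally show ?thesis by (rule matrix_inv_eqI[symmetric])
qed

lemma continuous_on_matrix_entries:
  fixes F :: "'x::topological_space \<Rightarrow> complex^'a^'b"
  assumes "\<And>i j. continuous_on S (\<lambda>z. F z $ i $ j)"
  shows "continuous_on S F"
proof -
  have "continuous_on S (\<lambda>z. \<chi> i j. F z $ i $ j)"
    by (intro continuous_on_vec_lambda assms)
  then show ?thesis by simp
qed

section \<open>The scalar penalty and its tangents\<close>

text \<open>The scalar function whose trace integral is the nonlinear part of the dual function.\<close>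

definition penalty :: "nat \<Rightarrow> real \<Rightarrow> real" where
  "penalty \<nu> x = (if \<nu> = 1 then - ln x else real \<nu> / (real \<nu> - 1) * x powr (1 - real \<nu>))"

lemma ln_less_minus_one:
  fixes t :: real
  assumes "0 < t" "t \<noteq> 1"
  shows "ln t < t - 1"
  using ln_le_minus_one[OF assms(1)] ln_eq_minus_one[OF assms(1)] assms(2) by linarith

text \<open>With \<open>t = a / b\<close> and \<open>k = \<nu> - 1\<close> both cases come down to \<open>ln t < t - 1\<close>, since \<open>t\<^bsup>-k\<^esup> = exp (- k ln t) \<ge> 1 - k ln t\<close>.\<close>

lemma penalty_above_tangent:
  assumes \<nu>: "1 \<le> \<nu>" and a: "0 < a" and b: "0 < b" and ne: "a \<noteq> b"
  shows "penalty \<nu> b + (a - b) * (- real \<nu> * b powr (- real \<nu>)) < penalty \<nu> a"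
proof -
  define t where "t = a / b"
  have t: "0 < t" "t \<noteq> 1" and at: "a = b * t" using a b ne by (auto simp: t_def)
  have ln: "ln t < t - 1" using t by (rule ln_less_minus_one)
  show ?thesis
  proof (cases "\<nu> = 1")
    case True
    have "b powr (-1) = 1 / b" using b by (simp add: powr_minus_divide)
    then have "(a - b) * (- real \<nu> * b powr (- real \<nu>)) = - (t - 1)"
      using b True by (simp add: at field_simps)
    then show ?thesis using ln b t True by (simp add: penalty_def at ln_mult)
  next
    case False
    define k where "k = real \<nu> - 1"
    have k: "0 < k" and \<nu>k: "real \<nu> = k + 1" using \<nu> False by (auto simp: k_def)
    have "1 - k * (t - 1) < 1 + (- k * ln t)" using ln k by simp
    also have "\<dots> \<le> exp (- k * ln t)" by (rule exp_ge_add_one_self)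
    also have "\<dots> = t powr (- k)" using t by (simp add: powr_def)
    finally have "b powr (- k) * (1 - k * (t - 1)) < b powr (- k) * t powr (- k)"
      using b by simp
    also have "\<dots> = a powr (- k)" using b t by (simp add: at powr_mult)
    finally have "(k + 1) / k * (b powr (- k) * (1 - k * (t - 1))) < (k + 1) / k * a powr (- k)"
      using k by (intro mult_strict_left_mono) auto
    moreover have "b powr (- k) = b * b powr (- (k + 1))"
      using b powr_add[of b 1 "- (k + 1)"] by simp
    then have "(k + 1) / k * (b powr (- k) * (1 - k * (t - 1)))
        = (k + 1) / k * b powr (- k) + (a - b) * (- (k + 1) * b powr (- (k + 1)))"
      using k by (simp add: at field_simps)
    ultimately show ?thesis using False by (simp add: penalty_def \<nu>k)
  qed
qed

lemma continuous_on_penalty: "continuous_on {0<..} (penalty \<nu>)"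
  unfolding penalty_def by (cases "\<nu> = 1") (auto intro!: continuous_intros)

section \<open>The parametric family\<close>

locale tau_family =
  fixes G :: "complex \<Rightarrow> complex^'m^'n" and \<Psi> W :: "complex \<Rightarrow> complex^'m^'m" and \<nu> :: nat
  assumes G_cont: "continuous_on unit_circle G"
    and G_cnj: "z \<in> unit_circle \<Longrightarrow> G (cnj z) = map_matrix cnj (G z)"
    and \<Psi>_cont: "continuous_on unit_circle \<Psi>"
    and \<Psi>_posdef: "z \<in> unit_circle \<Longrightarrow> posdef (\<Psi> z)"
    and \<Psi>_cnj: "z \<in> unit_circle \<Longrightarrow> \<Psi> (cnj z) = map_matrix cnj (\<Psi> z)"
    and W: "spectral_factor W \<Psi>"
    and \<nu>: "1 \<le> \<nu>"
begin

abbreviation "K \<equiv> dual_kernel G W \<nu>"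
abbreviation "D \<equiv> dual_domain G W \<nu>"
abbreviation "T \<equiv> tau_density G W \<nu>"

definition X :: "real^'n^'n \<Rightarrow> complex \<Rightarrow> complex^'m^'m" where
  "X \<Theta> z = hconj (G z) ** cmat \<Theta> ** G z"

text \<open>The factor \<open>W\<close> is only measurable and need not satisfy \<open>W (cnj z) = cnj (W z)\<close>. Continuity and
  conjugation symmetry are properties of this matrix function, which is congruent to the dual
  kernel and does not involve \<open>W\<close>.\<close>

definition S :: "real^'n^'n \<Rightarrow> complex \<Rightarrow> complex^'m^'m" where
  "S \<Theta> z = matrix_inv (\<Psi> z) + (1 / real \<nu>) *\<^sub>R X \<Theta> z"

text \<open>The inverse of \<open>W\<close>, written so that its measurability and boundedness can be read off.\<close>

definition V :: "complex \<Rightarrow> complex^'m^'m" where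
  "V z = hconj (W z) ** matrix_inv (\<Psi> z)"

lemma \<Psi>_factor: "z \<in> unit_circle \<Longrightarrow> W z ** hconj (W z) = \<Psi> z"
  using W by (simp add: spectral_factor_def)

lemma \<Psi>_inverse:
  assumes "z \<in> unit_circle"
  shows "\<Psi> z ** matrix_inv (\<Psi> z) = mat 1" "matrix_inv (\<Psi> z) ** \<Psi> z = mat 1"
    "hconj (\<Psi> z) = \<Psi> z" "hconj (matrix_inv (\<Psi> z)) = matrix_inv (\<Psi> z)"
  using posdef_inverse(1)[OF \<Psi>_posdef[OF assms]] \<Psi>_posdef[OF assms] posdef_matrix_inv[OF \<Psi>_posdef[OF assms]]
  by (auto simp: matrix_inv_cancel posdef_def hermitian_def)

lemma W_inverse:
  assumes "z \<in> unit_circle"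
  shows "W z ** V z = mat 1" "V z ** W z = mat 1"
    "hconj (V z) ** hconj (W z) = mat 1" "hconj (W z) ** hconj (V z) = mat 1"
proof -
  show 1: "W z ** V z = mat 1"
    by (simp add: V_def matrix_mul_assoc \<Psi>_factor[OF assms] \<Psi>_inverse[OF assms])
  show 2: "V z ** W z = mat 1" using 1 by (rule matrix_mult_1_comm)
  show "hconj (V z) ** hconj (W z) = mat 1" "hconj (W z) ** hconj (V z) = mat 1"
    using 1 2 by (simp_all flip: hconj_mult)
qed

lemma coercive_\<Psi>: "coercive \<Psi>"
  using \<Psi>_cont \<Psi>_posdef by (rule coercive_continuous)

lemma circle_bdd_W: "circle_bdd W"
proof (rule circle_bdd_factor)
  show "circle_measurable W" using W by (simp add: spectral_factor_def)
  have "circle_bdd \<Psi>" using coercive_\<Psi> by (simp add: coercive_def)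
  then show "circle_bdd (\<lambda>z. W z ** hconj (W z))" by (rule circle_bdd_eqI) (rule \<Psi>_factor)
qed

lemma circle_bdd_V: "circle_bdd V"
  unfolding V_def using coercive_\<Psi> by (intro circle_bdd_intros circle_bdd_W) (simp add: coercive_def)

lemma X_cont: "continuous_on unit_circle (X \<Theta>)"
  unfolding X_def
  by (intro continuous_on_matrix_mult continuous_on_hconj continuous_on_const G_cont)

lemma circle_bdd_X: "circle_bdd (X \<Theta>)"
  using X_cont by (rule circle_bdd_continuous)

lemma kernel_X: "K \<Theta> z = mat 1 + (1 / real \<nu>) *\<^sub>R (hconj (W z) ** X \<Theta> z ** W z)"
  by (simp add: dual_kernel_def X_def matrix_mul_assoc)

lemma kernel_S:
  assumes "z \<in> unit_circle"
  shows "K \<Theta> z = hconj (W z) ** S \<Theta> z ** W z"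
proof -
  have "hconj (W z) ** matrix_inv (\<Psi> z) ** W z = mat 1"
    using W_inverse(2)[OF assms] by (simp add: V_def)
  then show ?thesis
    by (simp add: kernel_X S_def matrix_add_ldistrib matrix_add_rdistrib matrix_scalar_ac
        flip: scalar_matrix_assoc)
qed

lemma S_kernel:
  assumes "z \<in> unit_circle"
  shows "S \<Theta> z = hconj (V z) ** K \<Theta> z ** V z"
proof -
  have "hconj (V z) ** K \<Theta> z ** V z
      = (hconj (V z) ** hconj (W z)) ** S \<Theta> z ** (W z ** V z)"
    by (simp add: kernel_S[OF assms] matrix_mul_assoc)
  then show ?thesis by (simp add: W_inverse[OF assms])
qed

lemma domainD:
  assumes "\<Theta> \<in> D"
  shows "transpose \<Theta> = \<Theta>" "\<And>z. z \<in> unit_circle \<Longrightarrow> posdef (K \<Theta> z)"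
  using assms unfolding dual_domain_def by blast+

lemma coercive_S:
  assumes \<Theta>: "\<Theta> \<in> D"
  shows "coercive (S \<Theta>)"
proof (rule coercive_continuous)
  show "continuous_on unit_circle (S \<Theta>)"
    unfolding S_def
    by (intro continuous_on_add continuous_on_scaleR continuous_on_const X_cont
        continuous_on_matrix_inv \<Psi>_cont posdef_inverse(1) \<Psi>_posdef)
  show "posdef (S \<Theta> z)" if z: "z \<in> unit_circle" for z
    unfolding S_kernel[OF z]
    by (intro posdef_congruence domainD[OF \<Theta>] z)
      (use W_inverse(1,2)[OF z] in \<open>auto simp: invertible_def\<close>)
qed

lemma coercive_K:
  assumes \<Theta>: "\<Theta> \<in> D"
  shows "coercive (K \<Theta>)"
proof -
  have "coercive (\<lambda>z. hconj (W z) ** S \<Theta> z ** W z)"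
    using coercive_S[OF \<Theta>] circle_bdd_W circle_bdd_V W_inverse(1) by (rule coercive_congruence)
  then show ?thesis using coercive_cong[of "K \<Theta>" "\<lambda>z. hconj (W z) ** S \<Theta> z ** W z"] kernel_S by blast
qed

lemma coercive_T:
  assumes \<Theta>: "\<Theta> \<in> D"
  shows "coercive (T \<Theta>)"
proof -
  have P: "coercive (\<lambda>z. mpowr (K \<Theta> z) (- real \<nu>))"
    unfolding mpowr_def
    by (rule coercive_herm_fun[OF coercive_K[OF \<Theta>]]) (auto intro!: continuous_intros)
  have "coercive (\<lambda>z. hconj (hconj (W z)) ** mpowr (K \<Theta> z) (- real \<nu>) ** hconj (W z))"
    by (rule coercive_congruence[OF P circle_bdd_hconj[OF circle_bdd_W] circle_bdd_hconj[OF circle_bdd_V]])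
      (rule W_inverse(4))
  then show ?thesis by (simp add: tau_density_def[abs_def])
qed

text \<open>Since \<open>W K\<^sup>-\<^sup>1 = S\<^sup>-\<^sup>1 \<Psi>\<^sup>-\<^sup>1 W\<close>, the density is \<open>(S\<^sup>-\<^sup>1 \<Psi>\<^sup>-\<^sup>1)\<^sup>\<nu> \<Psi>\<close>, from which \<open>W\<close> has
  disappeared.\<close>

lemma T_eq_funpow:
  assumes \<Theta>: "\<Theta> \<in> D" and z: "z \<in> unit_circle"
  shows "T \<Theta> z = (((**) (matrix_inv (S \<Theta> z) ** matrix_inv (\<Psi> z))) ^^ \<nu>) (\<Psi> z)"
proof -
  have K: "posdef (K \<Theta> z)" using domainD[OF \<Theta>] z by blast
  note KH = posdef_imp_hermitian[OF K]
  have "invertible (S \<Theta> z)" using coercive_S[OF \<Theta>] z by (simp add: coercive_def posdef_inverse)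
  note SS = matrix_inv_cancel(1)[OF this]
  have "K \<Theta> z ** (V z ** matrix_inv (S \<Theta> z) ** hconj (V z))
      = hconj (W z) ** (S \<Theta> z ** (W z ** V z) ** matrix_inv (S \<Theta> z)) ** hconj (V z)"
    by (simp add: kernel_S[OF z] matrix_mul_assoc)
  also have "\<dots> = mat 1" by (simp add: W_inverse[OF z] SS)
  finally have "matrix_inv (K \<Theta> z) = V z ** matrix_inv (S \<Theta> z) ** hconj (V z)"
    by (rule matrix_inv_eqI)
  then have "W z ** matrix_inv (K \<Theta> z) = (W z ** V z) ** matrix_inv (S \<Theta> z) ** hconj (V z)"
    by (simp add: matrix_mul_assoc)
  also have "\<dots> = matrix_inv (S \<Theta> z) ** matrix_inv (\<Psi> z) ** W z"
    by (simp add: W_inverse[OF z]) (simp add: V_def hconj_mult \<Psi>_inverse[OF z] matrix_mul_assoc)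
  finally have WK: "W z ** matrix_inv (K \<Theta> z) = matrix_inv (S \<Theta> z) ** matrix_inv (\<Psi> z) ** W z" .
  have "W z ** herm_fun (\<lambda>x. inverse x ^ k) (K \<Theta> z) ** hconj (W z)
      = (((**) (matrix_inv (S \<Theta> z) ** matrix_inv (\<Psi> z))) ^^ k) (\<Psi> z)" for k
  proof (induction k)
    case 0
    then show ?case by (simp add: herm_fun_const KH \<Psi>_factor[OF z])
  next
    case (Suc k)
    have "herm_fun (\<lambda>x. inverse x ^ Suc k) (K \<Theta> z)
        = matrix_inv (K \<Theta> z) ** herm_fun (\<lambda>x. inverse x ^ k) (K \<Theta> z)"
      by (simp add: herm_fun_mult KH posdef_inverse(2)[OF K])
    then have "W z ** herm_fun (\<lambda>x. inverse x ^ Suc k) (K \<Theta> z) ** hconj (W z)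
        = (W z ** matrix_inv (K \<Theta> z)) ** herm_fun (\<lambda>x. inverse x ^ k) (K \<Theta> z) ** hconj (W z)"
      by (simp only: matrix_mul_assoc)
    then show ?case by (simp add: WK flip: Suc.IH) (simp add: matrix_mul_assoc)
  qed
  moreover have "mpowr (K \<Theta> z) (- real \<nu>) = herm_fun (\<lambda>x. inverse x ^ \<nu>) (K \<Theta> z)"
    unfolding mpowr_def
    by (rule herm_fun_cong[OF K]) (simp add: powr_minus powr_realpow power_inverse)
  ultimately show ?thesis by (simp add: tau_density_def)
qed

lemma S_cnj:
  assumes z: "z \<in> unit_circle"
  shows "S \<Theta> (cnj z) = map_matrix cnj (S \<Theta> z)"
  by (simp add: S_def X_def map_cnj_add map_cnj_scaleR map_cnj_mult map_cnj_hconj map_cnj_inverse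
      G_cnj[OF z] \<Psi>_cnj[OF z] posdef_inverse(1)[OF \<Psi>_posdef[OF z]])

lemma T_cnj:
  assumes \<Theta>: "\<Theta> \<in> D" and z: "z \<in> unit_circle"
  shows "T \<Theta> (cnj z) = map_matrix cnj (T \<Theta> z)"
proof -
  have z': "cnj z \<in> unit_circle" using z by simp
  have S: "invertible (S \<Theta> z)" using coercive_S[OF \<Theta>] z by (simp add: coercive_def posdef_inverse)
  have Y: "matrix_inv (S \<Theta> (cnj z)) ** matrix_inv (\<Psi> (cnj z))
      = map_matrix cnj (matrix_inv (S \<Theta> z) ** matrix_inv (\<Psi> z))"
    by (simp add: map_cnj_mult map_cnj_inverse S posdef_inverse(1)[OF \<Psi>_posdef[OF z]] S_cnj[OF z] \<Psi>_cnj[OF z])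
  have "(((**) (map_matrix cnj Y)) ^^ k) (map_matrix cnj P) = map_matrix cnj ((((**) Y) ^^ k) P)"
    for Y P :: "complex^'m^'m" and k
    by (induction k) (simp_all add: map_cnj_mult)
  then show ?thesis
    unfolding T_eq_funpow[OF \<Theta> z'] T_eq_funpow[OF \<Theta> z] Y unfolding \<Psi>_cnj[OF z] by simp
qed

lemma T_spec_densities:
  assumes \<Theta>: "\<Theta> \<in> D"
  shows "T \<Theta> \<in> spec_densities"
proof -
  have T: "coercive (T \<Theta>)" by (rule coercive_T[OF \<Theta>])
  have herm: "hermitian (T \<Theta> z)" if "z \<in> unit_circle" for z
    using T that by (simp add: coercive_def posdef_def)
  obtain a b where ab: "0 < a" "0 < b" and spec: "\<And>z U d i. z \<in> unit_circle \<Longrightarrow> unitary_matrix U \<Longrightarrow>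
      T \<Theta> z = U ** real_diag d ** hconj U \<Longrightarrow> d i \<in> {a..b}"
    using coercive_spectrum[OF T] by metis
  have "psd (T \<Theta> z - a *\<^sub>R mat 1) \<and> psd (b *\<^sub>R mat 1 - T \<Theta> z)" if z: "z \<in> unit_circle" for z
  proof -
    obtain U d where U: "unitary_matrix U" and Tz: "T \<Theta> z = U ** real_diag d ** hconj U"
      using herm[OF z] by (rule hermitian_diagonalizable)
    have 1: "c *\<^sub>R mat 1 = U ** real_diag (\<lambda>i. c) ** hconj U" for c
      by (simp add: real_diag_const matrix_scalar_ac unitary_matrixD[OF U] flip: scalar_matrix_assoc)
    have 2: "U ** real_diag d1 ** hconj U - U ** real_diag d2 ** hconj U
        = U ** real_diag (\<lambda>i. d1 i - d2 i) ** hconj U" for d1 d2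
    proof -
      have "real_diag (\<lambda>i. d1 i - d2 i) + real_diag d2 = (real_diag d1 :: complex^'m^'m)"
        by (simp add: vec_eq_iff real_diag_nth)
      then have "U ** real_diag (\<lambda>i. d1 i - d2 i) ** hconj U + U ** real_diag d2 ** hconj U
          = U ** real_diag d1 ** hconj U"
        by (simp flip: matrix_add_ldistrib matrix_add_rdistrib)
      then show ?thesis by (simp add: algebra_simps)
    qed
    show ?thesis
      using spec[OF z U Tz] unfolding Tz 1 2 psd_diag[OF U] by simp
  qed
  then show ?thesis
    using T herm T_cnj[OF \<Theta>] ab unfolding spec_densities_def coercive_def circle_bdd_def by blast
qed

section \<open>The common part of dual function and divergence\<close>

text \<open>The part that the dual function and the divergence share.\<close>

definition reduced_dual :: "(complex \<Rightarrow> complex^'m^'m) \<Rightarrow> real^'n^'n \<Rightarrow> real" where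
  "reduced_dual \<Omega> \<Theta> = tr_int (\<lambda>z. herm_fun (penalty \<nu>) (K \<Theta> z)) + tr_int (\<lambda>z. \<Omega> z ** X \<Theta> z)"

lemma circle_bdd_penalty: "\<Theta> \<in> D \<Longrightarrow> circle_bdd (\<lambda>z. herm_fun (penalty \<nu>) (K \<Theta> z))"
  by (intro circle_bdd_herm_fun coercive_K continuous_on_penalty)

text \<open>In the weighted coordinates the density becomes \<open>U\<^sup>* K\<^sup>-\<^sup>\<nu> U\<close> with the unitary \<open>U = W\<^sup>* W\<^sub>Q\<close>. The
  exponents of the divergence then produce the penalty of \<open>K\<close>, and \<open>K\<close> itself, which is affine in
  \<open>\<Theta>\<close>, paired with the weighted data.\<close>

lemma weighted_beta_div_eq:
  assumes \<Omega>: "coercive \<Omega>" and WQ: "spectral_factor WQ (\<lambda>z. matrix_inv (\<Psi> z))"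
  obtains c where "\<And>\<Theta>. \<Theta> \<in> D \<Longrightarrow>
    weighted_beta_div WQ (1 - 1 / real \<nu>) \<Omega> (T \<Theta>) = c + reduced_dual \<Omega> \<Theta>"
proof -
  define O1 where "O1 z = hconj (WQ z) ** \<Omega> z ** WQ z" for z
  define U where "U z = hconj (W z) ** WQ z" for z
  have Q: "WQ z ** hconj (WQ z) = matrix_inv (\<Psi> z)" if "z \<in> unit_circle" for z
    using WQ that by (simp add: spectral_factor_def)
  have "circle_bdd (\<lambda>z. matrix_inv (\<Psi> z))" using coercive_\<Psi> by (simp add: coercive_def)
  then have "circle_bdd (\<lambda>z. WQ z ** hconj (WQ z))" by (rule circle_bdd_eqI) (rule Q)
  with WQ have WQ_bdd: "circle_bdd WQ"
    unfolding spectral_factor_def by (elim conjE) (rule circle_bdd_factor)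
  have WQ_inv: "WQ z ** (hconj (WQ z) ** \<Psi> z) = mat 1" if "z \<in> unit_circle" for z
    using that by (simp add: matrix_mul_assoc Q[OF that] \<Psi>_inverse[OF that])
  have WQ_inv_bdd: "circle_bdd (\<lambda>z. hconj (WQ z) ** \<Psi> z)"
    using coercive_\<Psi> by (intro circle_bdd_intros WQ_bdd) (simp add: coercive_def)
  note congr = coercive_congruence[OF _ WQ_bdd WQ_inv_bdd WQ_inv]
  have O1: "coercive O1" unfolding O1_def[abs_def] using \<Omega> by (rule congr)
  then have O1_bdd: "circle_bdd O1" by (simp add: coercive_def)
  have U: "unitary_matrix (U z)" if z: "z \<in> unit_circle" for z
  proof -
    have "U z ** hconj (U z) = hconj (W z) ** (WQ z ** hconj (WQ z)) ** W z"
      by (simp add: U_def hconj_mult matrix_mul_assoc)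
    also have "\<dots> = mat 1" using W_inverse(2)[OF z] by (simp add: Q[OF z] V_def)
    finally show ?thesis by (simp add: unitary_matrix_def matrix_mult_1_comm)
  qed
  \<comment> \<open>the mixed term is affine in \<open>\<Theta>\<close>: the weights cancel against \<open>\<Psi>\<close> around the trace\<close>
  have main: "Re (trace (O1 z ** (hconj (U z) ** K \<Theta> z ** U z)))
      = Re (trace (O1 z)) + (1 / real \<nu>) * Re (trace (\<Omega> z ** X \<Theta> z))" if z: "z \<in> unit_circle" for z \<Theta>
  proof -
    have WU: "W z ** U z = \<Psi> z ** WQ z" by (simp add: U_def matrix_mul_assoc \<Psi>_factor[OF z])
    have UW: "hconj (U z) ** hconj (W z) = hconj (WQ z) ** \<Psi> z"
      using arg_cong[OF WU, of hconj] by (simp add: hconj_mult \<Psi>_inverse[OF z])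
    have "hconj (U z) ** K \<Theta> z ** U z
        = mat 1 + (1 / real \<nu>) *\<^sub>R ((hconj (U z) ** hconj (W z)) ** X \<Theta> z ** (W z ** U z))"
      by (simp add: kernel_X matrix_add_ldistrib matrix_add_rdistrib matrix_scalar_ac
          unitary_matrixD[OF U[OF z]] matrix_mul_assoc flip: scalar_matrix_assoc)
    then have "O1 z ** (hconj (U z) ** K \<Theta> z ** U z) = O1 z + (1 / real \<nu>) *\<^sub>R
        (hconj (WQ z) ** (\<Omega> z ** (WQ z ** (hconj (WQ z) ** \<Psi> z)) ** X \<Theta> z ** \<Psi> z ** WQ z))"
      by (simp add: UW WU matrix_add_ldistrib matrix_scalar_ac O1_def matrix_mul_assoc
          flip: scalar_matrix_assoc)
    moreover have "trace (hconj (WQ z) ** (\<Omega> z ** (WQ z ** (hconj (WQ z) ** \<Psi> z)) ** X \<Theta> z ** \<Psi> z ** WQ z))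
        = trace (\<Omega> z ** X \<Theta> z)"
    proof -
      have "\<Psi> z ** WQ z ** hconj (WQ z) = mat 1"
        by (simp add: Q[OF z] \<Psi>_inverse[OF z] flip: matrix_mul_assoc)
      then show ?thesis
        by (subst trace_mul_sym) (simp add: WQ_inv[OF z] flip: matrix_mul_assoc)
    qed
    ultimately show ?thesis
      by (simp add: linear_simps[OF bounded_linear_Re_trace])
  qed
  \<comment> \<open>has the trace of what does not depend on \<open>\<Theta>\<close> in the integrand\<close>
  define C where "C z = (if \<nu> = 1 then O1 z - mlog (O1 z) - mat 1
      else (1 / ((1 - 1 / real \<nu>) * (1 - 1 / real \<nu> - 1))) *\<^sub>R mpowr (O1 z) (1 - 1 / real \<nu>)
        + real \<nu> *\<^sub>R O1 z)" for z
  have pow_bdd: "circle_bdd (\<lambda>z. mpowr (M z) s)" if "coercive M" for s and M :: "complex \<Rightarrow> complex^'m^'m"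
    unfolding mpowr_def by (rule circle_bdd_herm_fun[OF that]) (auto intro!: continuous_intros)
  have log_bdd: "circle_bdd (\<lambda>z. mlog (M z))" if "coercive M" for M :: "complex \<Rightarrow> complex^'m^'m"
    unfolding mlog_def by (rule circle_bdd_herm_fun[OF that]) (auto intro!: continuous_intros)
  have C_bdd: "circle_bdd C"
    unfolding C_def[abs_def]
    by (cases "\<nu> = 1") (simp_all add: circle_bdd_intros O1_bdd pow_bdd[OF O1] log_bdd[OF O1])
  have "weighted_beta_div WQ (1 - 1 / real \<nu>) \<Omega> (T \<Theta>) = tr_int C + reduced_dual \<Omega> \<Theta>" if \<Theta>: "\<Theta> \<in> D" for \<Theta>
  proof -
    define T1 where "T1 z = hconj (WQ z) ** T \<Theta> z ** WQ z" for z
    have T1: "coercive T1" unfolding T1_def[abs_def] using coercive_T[OF \<Theta>] by (rule congr)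
    have posK: "posdef (K \<Theta> z)" if "z \<in> unit_circle" for z using domainD(2)[OF \<Theta> that] .
    \<comment> \<open>functions of the weighted density are functions of the kernel in another orthonormal basis\<close>
    have T1_fun: "herm_fun f (T1 z) = hconj (U z) ** herm_fun g (K \<Theta> z) ** U z"
      if z: "z \<in> unit_circle" and g: "\<And>x. 0 < x \<Longrightarrow> f (x powr - real \<nu>) = g x" for f g z
    proof -
      note H = posdef_imp_hermitian[OF posK[OF z]]
      have "T1 z = hconj (U z) ** herm_fun (\<lambda>x. x powr - real \<nu>) (K \<Theta> z) ** U z"
        by (simp add: T1_def U_def tau_density_def mpowr_def hconj_mult matrix_mul_assoc)
      then have "herm_fun f (T1 z)
          = hconj (U z) ** herm_fun (\<lambda>x. f (x powr - real \<nu>)) (K \<Theta> z) ** U z"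
        by (simp add: herm_fun_unitary_conj hermitian_herm_fun H U[OF z] herm_fun_comp)
      also have "herm_fun (\<lambda>x. f (x powr - real \<nu>)) (K \<Theta> z) = herm_fun g (K \<Theta> z)"
        using posK[OF z] g by (rule herm_fun_cong)
      finally show ?thesis .
    qed
    have T1_K: "herm_fun f (T1 z) = hconj (U z) ** K \<Theta> z ** U z"
      if z: "z \<in> unit_circle" and f: "\<And>x. 0 < x \<Longrightarrow> f (x powr - real \<nu>) = x" for f z
      using T1_fun[where f = f and g = "\<lambda>x. x", OF z f] herm_fun_id[OF posdef_imp_hermitian[OF posK[OF z]]] by simp
    have rhs_bdd: "circle_bdd (\<lambda>z. C z + (herm_fun (penalty \<nu>) (K \<Theta> z) + \<Omega> z ** X \<Theta> z))"
      using \<Omega> by (intro circle_bdd_add circle_bdd_mult C_bdd circle_bdd_penalty \<Theta> circle_bdd_X)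
        (simp add: coercive_def)
    have wd: "weighted_beta_div WQ (1 - 1 / real \<nu>) \<Omega> (T \<Theta>) = beta_div (1 - 1 / real \<nu>) O1 T1"
      by (simp add: weighted_beta_div_def O1_def[abs_def] T1_def[abs_def])
    have "weighted_beta_div WQ (1 - 1 / real \<nu>) \<Omega> (T \<Theta>)
        = tr_int (\<lambda>z. C z + (herm_fun (penalty \<nu>) (K \<Theta> z) + \<Omega> z ** X \<Theta> z))"
    proof (cases "\<nu> = 1")
      case True
      have inv: "matrix_inv (T1 z) = hconj (U z) ** K \<Theta> z ** U z" if z: "z \<in> unit_circle" for z
      proof -
        have "posdef (T1 z)" using T1 z by (simp add: coercive_def)
        then have "matrix_inv (T1 z) = herm_fun inverse (T1 z)" by (rule posdef_inverse)
        also have "\<dots> = hconj (U z) ** K \<Theta> z ** U z"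
          using z by (rule T1_K) (simp add: True powr_minus)
        finally show ?thesis .
      qed
      have log: "mlog (T1 z) = hconj (U z) ** herm_fun (penalty \<nu>) (K \<Theta> z) ** U z"
        if z: "z \<in> unit_circle" for z
        unfolding mlog_def using z by (rule T1_fun) (simp add: True penalty_def ln_div)
      have "tr_int (\<lambda>z. mlog (T1 z) - mlog (O1 z) + O1 z ** matrix_inv (T1 z) - mat 1)
          = tr_int (\<lambda>z. C z + (herm_fun (penalty \<nu>) (K \<Theta> z) + \<Omega> z ** X \<Theta> z))"
      proof (rule tr_int_cong[OF _ rhs_bdd])
        show "circle_bdd (\<lambda>z. mlog (T1 z) - mlog (O1 z) + O1 z ** matrix_inv (T1 z) - mat 1)"
          using T1 by (intro circle_bdd_intros log_bdd T1 O1 O1_bdd) (simp add: coercive_def)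
        show "Re (trace (mlog (T1 z) - mlog (O1 z) + O1 z ** matrix_inv (T1 z) - mat 1))
            = Re (trace (C z + (herm_fun (penalty \<nu>) (K \<Theta> z) + \<Omega> z ** X \<Theta> z)))"
          if z: "z \<in> unit_circle" for z
          using main[OF z, of \<Theta>] True
          by (simp add: inv[OF z] log[OF z] C_def trace_add trace_sub trace_unitary_conj U[OF z])
      qed
      then show ?thesis unfolding wd by (simp add: beta_div_def is_div_def True)
    next
      case False
      define b where "b = 1 - 1 / real \<nu>"
      have b: "b \<noteq> 0" "1 / b = real \<nu> / (real \<nu> - 1)" "1 / (b - 1) = - real \<nu>" "real \<nu> * b = real \<nu> - 1"
        "real \<nu> * (b - 1) = - 1"
        using \<nu> False by (simp_all add: b_def field_simps)
      have pow1: "mpowr (T1 z) (b - 1) = hconj (U z) ** K \<Theta> z ** U z" if z: "z \<in> unit_circle" for z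
        unfolding mpowr_def using z by (rule T1_K) (simp add: powr_powr b)
      have pow2: "(1 / b) *\<^sub>R mpowr (T1 z) b = hconj (U z) ** herm_fun (penalty \<nu>) (K \<Theta> z) ** U z"
        if z: "z \<in> unit_circle" for z
      proof -
        have "hermitian (T1 z)" using T1 z by (simp add: coercive_def posdef_imp_hermitian)
        then have "(1 / b) *\<^sub>R mpowr (T1 z) b = herm_fun (\<lambda>x. 1 / b * x powr b) (T1 z)"
          unfolding mpowr_def by (rule herm_fun_cmult[symmetric])
        also have "\<dots> = hconj (U z) ** herm_fun (penalty \<nu>) (K \<Theta> z) ** U z"
          using z by (rule T1_fun) (use False in \<open>simp add: powr_powr b penalty_def\<close>)
        finally show ?thesis .
      qed
      have "tr_int (\<lambda>z. (1 / (b * (b - 1))) *\<^sub>R mpowr (O1 z) b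
            - (1 / (b - 1)) *\<^sub>R (O1 z ** mpowr (T1 z) (b - 1)) + (1 / b) *\<^sub>R mpowr (T1 z) b)
          = tr_int (\<lambda>z. C z + (herm_fun (penalty \<nu>) (K \<Theta> z) + \<Omega> z ** X \<Theta> z))"
      proof (rule tr_int_cong[OF _ rhs_bdd])
        show "circle_bdd (\<lambda>z. (1 / (b * (b - 1))) *\<^sub>R mpowr (O1 z) b
            - (1 / (b - 1)) *\<^sub>R (O1 z ** mpowr (T1 z) (b - 1)) + (1 / b) *\<^sub>R mpowr (T1 z) b)"
          by (intro circle_bdd_intros pow_bdd T1 O1 O1_bdd)
        show "Re (trace ((1 / (b * (b - 1))) *\<^sub>R mpowr (O1 z) b
            - (1 / (b - 1)) *\<^sub>R (O1 z ** mpowr (T1 z) (b - 1)) + (1 / b) *\<^sub>R mpowr (T1 z) b))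
            = Re (trace (C z + (herm_fun (penalty \<nu>) (K \<Theta> z) + \<Omega> z ** X \<Theta> z)))"
          if z: "z \<in> unit_circle" for z
        proof -
          have sc: "Re (trace (r *\<^sub>R M)) = r * Re (trace M)" for r and M :: "complex^'m^'m"
            by (simp add: linear_simps(5)[OF bounded_linear_Re_trace])
          show ?thesis
            unfolding pow1[OF z] pow2[OF z]
            using main[OF z, of \<Theta>] False \<nu>
            by (simp add: b(3) C_def b_def[symmetric] trace_add trace_sub sc trace_unitary_conj U[OF z]
                distrib_left)
        qed
      qed
      then show ?thesis unfolding wd using b(1) by (simp add: beta_div_def b_def[symmetric])
    qed
    also have "\<dots> = tr_int C + reduced_dual \<Omega> \<Theta>"
    proof -
      have "circle_bdd (\<lambda>z. \<Omega> z ** X \<Theta> z)"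
        using \<Omega> by (intro circle_bdd_mult circle_bdd_X) (simp add: coercive_def)
      then show ?thesis
        by (simp add: reduced_dual_def tr_int_add C_bdd circle_bdd_penalty[OF \<Theta>] circle_bdd_add)
    qed
    finally show ?thesis .
  qed
  then show thesis by (rule that)
qed

text \<open>The moment \<open>\<Sigma>\<close> turns the linear term into \<open>tr \<integral> \<Omega> G\<^sup>* \<Theta> G\<close> by cyclicity of the trace. For \<open>\<nu> = 1\<close> the
  logarithm is that of \<open>S\<^sup>-\<^sup>1\<close>, and \<open>det K = det S det \<Psi>\<close> makes \<open>tr \<integral> log \<Psi>\<close> the constant; for \<open>\<nu> > 1\<close> the
  constant is zero.\<close>

lemma dual_fun_eq:
  assumes \<Omega>: "circle_bdd \<Omega>"
    and \<Sigma>: "\<Sigma> = circle_integral (\<lambda>z. G z ** \<Omega> z ** hconj (G z))"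
  obtains c where "\<And>\<Theta>. \<Theta> \<in> D \<Longrightarrow> dual_fun G \<Psi> W \<Sigma> \<nu> \<Theta> = c + reduced_dual \<Omega> \<Theta>"
proof -
  have GOG: "circle_bdd (\<lambda>z. G z ** \<Omega> z ** hconj (G z))"
    by (intro circle_bdd_intros \<Omega> circle_bdd_continuous G_cont)
  have lin: "Re (trace (\<Sigma> ** cmat \<Theta>)) = tr_int (\<lambda>z. \<Omega> z ** X \<Theta> z)" for \<Theta>
    unfolding \<Sigma> trace_circle_integral_mult[OF GOG]
  proof (rule tr_int_cong)
    show "circle_bdd (\<lambda>z. G z ** \<Omega> z ** hconj (G z) ** cmat \<Theta>)"
      by (intro circle_bdd_mult[OF GOG] circle_bdd_const)
    show "circle_bdd (\<lambda>z. \<Omega> z ** X \<Theta> z)" by (intro circle_bdd_mult \<Omega> circle_bdd_X)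
    fix z
    have "trace (G z ** (\<Omega> z ** hconj (G z) ** cmat \<Theta>)) = trace ((\<Omega> z ** hconj (G z) ** cmat \<Theta>) ** G z)"
      by (rule trace_mul_sym)
    then show "Re (trace (G z ** \<Omega> z ** hconj (G z) ** cmat \<Theta>)) = Re (trace (\<Omega> z ** X \<Theta> z))"
      by (simp add: X_def matrix_mul_assoc)
  qed
  show thesis
  proof (cases "\<nu> = 1")
    case True
    have "dual_fun G \<Psi> W \<Sigma> \<nu> \<Theta> = tr_int (\<lambda>z. mlog (\<Psi> z)) + reduced_dual \<Omega> \<Theta>" if \<Theta>: "\<Theta> \<in> D" for \<Theta>
    proof -
      have S: "matrix_inv (\<Psi> z) + hconj (G z) ** cmat \<Theta> ** G z = S \<Theta> z" for z
        unfolding S_def X_def using True by simp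
      have log_bdd: "circle_bdd (\<lambda>z. herm_fun ln (M z))" if "coercive M" for M :: "complex \<Rightarrow> complex^'m^'m"
        by (rule circle_bdd_herm_fun[OF that]) (auto intro!: continuous_intros)
      have "tr_int (\<lambda>z. mlog (matrix_inv (S \<Theta> z)))
          = tr_int (\<lambda>z. mlog (\<Psi> z) + herm_fun (penalty \<nu>) (K \<Theta> z))"
      proof (rule tr_int_cong)
        have pos: "posdef (S \<Theta> z)" if "z \<in> unit_circle" for z
          using coercive_S[OF \<Theta>] that by (simp add: coercive_def)
        have "coercive (\<lambda>z. herm_fun inverse (S \<Theta> z))"
          by (rule coercive_herm_fun[OF coercive_S[OF \<Theta>]]) (auto intro!: continuous_intros)
        moreover have "matrix_inv (S \<Theta> z) = herm_fun inverse (S \<Theta> z)" if "z \<in> unit_circle" for z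
          using pos[OF that] by (rule posdef_inverse)
        ultimately have "coercive (\<lambda>z. matrix_inv (S \<Theta> z))"
          using coercive_cong[of "\<lambda>z. matrix_inv (S \<Theta> z)" "\<lambda>z. herm_fun inverse (S \<Theta> z)"] by blast
        then show "circle_bdd (\<lambda>z. mlog (matrix_inv (S \<Theta> z)))" unfolding mlog_def by (rule log_bdd)
        show "circle_bdd (\<lambda>z. mlog (\<Psi> z) + herm_fun (penalty \<nu>) (K \<Theta> z))"
          unfolding mlog_def by (intro circle_bdd_add circle_bdd_penalty \<Theta> log_bdd coercive_\<Psi>)
        show "Re (trace (mlog (matrix_inv (S \<Theta> z)))) = Re (trace (mlog (\<Psi> z) + herm_fun (penalty \<nu>) (K \<Theta> z)))"
          if z: "z \<in> unit_circle" for z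
        proof -
          note posK = domainD(2)[OF \<Theta> z]
          have pen: "Re (trace (herm_fun (penalty \<nu>) (K \<Theta> z))) = - Re (trace (mlog (K \<Theta> z)))"
          proof -
            have "herm_fun (penalty \<nu>) (K \<Theta> z) = herm_fun (\<lambda>x. (-1) * ln x) (K \<Theta> z)"
              by (rule herm_fun_cong[OF posK]) (simp add: penalty_def True)
            also have "\<dots> = (-1) *\<^sub>R mlog (K \<Theta> z)"
              unfolding mlog_def by (rule herm_fun_cmult[OF posdef_imp_hermitian[OF posK]])
            finally show ?thesis by (simp add: linear_simps[OF bounded_linear_Re_trace])
          qed
          have "det (K \<Theta> z) = det (S \<Theta> z) * (det (W z) * det (hconj (W z)))"
            by (simp add: kernel_S[OF z] det_mul mult_ac)
          then have detK: "det (K \<Theta> z) = det (S \<Theta> z) * det (\<Psi> z)"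
            by (simp add: \<Psi>_factor[OF z] flip: det_mul)
          have detS: "det (S \<Theta> z) * det (matrix_inv (S \<Theta> z)) = 1"
            using matrix_inv_cancel(1)[OF posdef_inverse(1)[OF pos[OF z]]] by (simp flip: det_mul)
          have "cmod (det (matrix_inv (S \<Theta> z))) * cmod (det (S \<Theta> z)) = 1"
            using arg_cong[OF detS, of cmod] by (simp add: norm_mult mult.commute)
          moreover have "det (S \<Theta> z) \<noteq> 0" "det (\<Psi> z) \<noteq> 0"
            using trace_mlog(2) pos[OF z] \<Psi>_posdef[OF z] by blast+
          ultimately have "cmod (det (matrix_inv (S \<Theta> z))) * cmod (det (K \<Theta> z)) = cmod (det (\<Psi> z))"
            by (simp add: detK norm_mult)
          moreover have "cmod (det (matrix_inv (S \<Theta> z))) > 0" "cmod (det (K \<Theta> z)) > 0"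
            using detS detK \<open>det (S \<Theta> z) \<noteq> 0\<close> \<open>det (\<Psi> z) \<noteq> 0\<close> by auto
          ultimately have "ln (cmod (det (matrix_inv (S \<Theta> z)))) + ln (cmod (det (K \<Theta> z))) = ln (cmod (det (\<Psi> z)))"
            by (metis ln_mult_pos)
          then show ?thesis
            using trace_mlog(1)[OF posdef_matrix_inv[OF pos[OF z]]] trace_mlog(1)[OF posK]
              trace_mlog(1)[OF \<Psi>_posdef[OF z]] pen
            by (simp add: trace_add)
        qed
      qed
      also have "\<dots> = tr_int (\<lambda>z. mlog (\<Psi> z)) + tr_int (\<lambda>z. herm_fun (penalty \<nu>) (K \<Theta> z))"
        unfolding mlog_def by (intro tr_int_add circle_bdd_penalty \<Theta> log_bdd coercive_\<Psi>)
      finally show ?thesis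
        unfolding dual_fun_def S reduced_dual_def lin using True by simp
    qed
    then show thesis by (rule that)
  next
    case False
    have "dual_fun G \<Psi> W \<Sigma> \<nu> \<Theta> = 0 + reduced_dual \<Omega> \<Theta>" if \<Theta>: "\<Theta> \<in> D" for \<Theta>
    proof -
      have pow_bdd: "circle_bdd (\<lambda>z. mpowr (K \<Theta> z) (1 - real \<nu>))"
        unfolding mpowr_def
        by (rule circle_bdd_herm_fun[OF coercive_K[OF \<Theta>]]) (auto intro!: continuous_intros)
      have "real \<nu> / (real \<nu> - 1) * tr_int (\<lambda>z. mpowr (K \<Theta> z) (1 - real \<nu>))
          = tr_int (\<lambda>z. (real \<nu> / (real \<nu> - 1)) *\<^sub>R mpowr (K \<Theta> z) (1 - real \<nu>))"
        by (rule tr_int_scaleR[OF pow_bdd, symmetric])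
      also have "\<dots> = tr_int (\<lambda>z. herm_fun (penalty \<nu>) (K \<Theta> z))"
      proof (rule tr_int_cong[OF circle_bdd_scaleR[OF pow_bdd] circle_bdd_penalty[OF \<Theta>]])
        fix z :: complex assume z: "z \<in> unit_circle"
        have "herm_fun (penalty \<nu>) (K \<Theta> z) = herm_fun (\<lambda>x. real \<nu> / (real \<nu> - 1) * x powr (1 - real \<nu>)) (K \<Theta> z)"
          by (rule herm_fun_cong[OF domainD(2)[OF \<Theta> z]]) (use False in \<open>simp add: penalty_def\<close>)
        also have "\<dots> = (real \<nu> / (real \<nu> - 1)) *\<^sub>R mpowr (K \<Theta> z) (1 - real \<nu>)"
          unfolding mpowr_def by (rule herm_fun_cmult[OF posdef_imp_hermitian[OF domainD(2)[OF \<Theta> z]]])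
        finally show "Re (trace ((real \<nu> / (real \<nu> - 1)) *\<^sub>R mpowr (K \<Theta> z) (1 - real \<nu>)))
            = Re (trace (herm_fun (penalty \<nu>) (K \<Theta> z)))" by simp
      qed
      finally show ?thesis using False by (simp add: dual_fun_def reduced_dual_def lin)
    qed
    then show thesis by (rule that)
  qed
qed

section \<open>Minimizers determine the density\<close>

lemma domain_midpoint:
  assumes "\<Theta>1 \<in> D" "\<Theta>2 \<in> D"
  shows "(1/2) *\<^sub>R (\<Theta>1 + \<Theta>2) \<in> D" "X ((1/2) *\<^sub>R (\<Theta>1 + \<Theta>2)) z = (1/2) *\<^sub>R (X \<Theta>1 z + X \<Theta>2 z)"
    "K ((1/2) *\<^sub>R (\<Theta>1 + \<Theta>2)) z = (1/2) *\<^sub>R (K \<Theta>1 z + K \<Theta>2 z)"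
proof -
  let ?M = "(1/2) *\<^sub>R (\<Theta>1 + \<Theta>2)"
  have cm: "cmat ?M = (1/2) *\<^sub>R (cmat \<Theta>1 + cmat \<Theta>2)" by (simp add: vec_eq_iff cmat_def complex_scaleR)
  show X: "X ?M z = (1/2) *\<^sub>R (X \<Theta>1 z + X \<Theta>2 z)" for z
    unfolding X_def cm
    by (simp add: matrix_add_ldistrib matrix_add_rdistrib matrix_scalar_ac scaleR_add_right
        flip: scalar_matrix_assoc)
  have "mat 1 = (1/2) *\<^sub>R (mat 1 + mat 1 :: complex^'m^'m)" by (simp flip: scaleR_2)
  then show K: "K ?M z = (1/2) *\<^sub>R (K \<Theta>1 z + K \<Theta>2 z)" for z
    unfolding kernel_X X
    by (simp add: matrix_add_ldistrib matrix_add_rdistrib matrix_scalar_ac scaleR_add_right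
        flip: scalar_matrix_assoc) (simp add: algebra_simps)
  have "posdef (K ?M z)" if z: "z \<in> unit_circle" for z
  proof -
    have sum: "hform ((1/2) *\<^sub>R (A + B)) v = (1/2) *\<^sub>R (hform A v + hform B v)" for A B :: "complex^'m^'m" and v
      by (simp add: hform_def matrix_vector_mult_def complex_scaleR sum_distrib_left sum.distrib
          algebra_simps)
    show ?thesis
      using domainD(2)[OF assms(1) z] domainD(2)[OF assms(2) z]
      unfolding K posdef_def by (auto simp: sum hermitian_def hconj_scaleR hconj_add add_pos_pos)
  qed
  moreover have "transpose ?M = ?M"
    using domainD(1)[OF assms(1)] domainD(1)[OF assms(2)] by (simp add: vec_eq_iff transpose_def)
  ultimately show "?M \<in> D" unfolding dual_domain_def by blast
qed

text \<open>At the midpoint of two minimizers the function cannot be smaller, so that the pointwise convexity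
  gap of the trace of the penalty has a nonpositive integral. Klein's inequality at the midpoint
  makes the gap nonnegative and, where it vanishes, forces the two kernels to agree.\<close>

lemma reduced_dual_minimizers_agree:
  assumes \<Omega>: "circle_bdd \<Omega>" and \<Theta>: "\<Theta>1 \<in> D" "\<Theta>2 \<in> D" and eq: "reduced_dual \<Omega> \<Theta>1 = reduced_dual \<Omega> \<Theta>2"
    and min: "\<And>\<Theta>. \<Theta> \<in> D \<Longrightarrow> reduced_dual \<Omega> \<Theta>1 \<le> reduced_dual \<Omega> \<Theta>" and z: "z \<in> unit_circle"
  shows "T \<Theta>1 z = T \<Theta>2 z"
proof -
  define \<Theta>m where "\<Theta>m = (1/2) *\<^sub>R (\<Theta>1 + \<Theta>2)"
  have \<Theta>m: "\<Theta>m \<in> D" unfolding \<Theta>m_def by (rule domain_midpoint(1)[OF \<Theta>])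
  let ?p = "\<lambda>\<Theta> z. herm_fun (penalty \<nu>) (K \<Theta> z)"
  \<comment> \<open>twice the convexity gap at the midpoint\<close>
  define F where "F z = ?p \<Theta>1 z + ?p \<Theta>2 z - 2 *\<^sub>R ?p \<Theta>m z" for z
  have F_bdd: "circle_bdd F"
    unfolding F_def[abs_def] by (intro circle_bdd_intros circle_bdd_penalty \<Theta> \<Theta>m)
  have ReF: "Re (trace (F z)) = Re (trace (?p \<Theta>1 z)) + Re (trace (?p \<Theta>2 z)) - 2 * Re (trace (?p \<Theta>m z))" for z
    unfolding F_def by (simp add: linear_simps[OF bounded_linear_Re_trace])
  have gap: "0 \<le> Re (trace (F z))" "Re (trace (F z)) = 0 \<Longrightarrow> K \<Theta>1 z = K \<Theta>2 z"
    if z: "z \<in> unit_circle" for z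
  proof -
    \<comment> \<open>the derivative of the penalty\<close>
    define g where "g x = - real \<nu> * x powr (- real \<nu>)" for x
    note klein = klein_inequality[OF domainD(2)[OF _ z] domainD(2)[OF \<Theta>m z], where f = "penalty \<nu>" and g = g]
    have tangent: "penalty \<nu> b + (a - b) * g b < penalty \<nu> a" if "0 < a" "0 < b" "a \<noteq> b" for a b
      unfolding g_def using \<nu> that by (rule penalty_above_tangent)
    let ?l = "\<lambda>\<Theta>. Re (trace ((K \<Theta> z - K \<Theta>m z) ** herm_fun g (K \<Theta>m z)))"
    have "(K \<Theta>1 z - K \<Theta>m z) + (K \<Theta>2 z - K \<Theta>m z) = 0"
      unfolding \<Theta>m_def domain_midpoint(3)[OF \<Theta>] by (simp add: algebra_simps flip: scaleR_2)
    then have "?l \<Theta>1 + ?l \<Theta>2 = 0"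
      by (simp flip: trace_add plus_complex.sel(1) matrix_add_rdistrib)
        (simp add: trace_def matrix_matrix_mult_def)
    moreover note k1 = klein(1)[OF \<Theta>(1) tangent] and k2 = klein(1)[OF \<Theta>(2) tangent]
    ultimately show "0 \<le> Re (trace (F z))" unfolding ReF by linarith
    assume "Re (trace (F z)) = 0"
    then have "Re (trace (?p \<Theta>m z)) + ?l \<Theta>1 = Re (trace (?p \<Theta>1 z))"
      "Re (trace (?p \<Theta>m z)) + ?l \<Theta>2 = Re (trace (?p \<Theta>2 z))"
      using \<open>?l \<Theta>1 + ?l \<Theta>2 = 0\<close> k1 k2 unfolding ReF by linarith+
    then show "K \<Theta>1 z = K \<Theta>2 z"
      using klein(2)[OF \<Theta>(1) tangent] klein(2)[OF \<Theta>(2) tangent] by metis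
  qed
  have OX: "circle_bdd (\<lambda>z. \<Omega> z ** X \<Theta> z)" for \<Theta> by (intro circle_bdd_mult \<Omega> circle_bdd_X)
  have "tr_int (\<lambda>z. \<Omega> z ** X \<Theta>m z) = tr_int (\<lambda>z. (1/2) *\<^sub>R (\<Omega> z ** X \<Theta>1 z + \<Omega> z ** X \<Theta>2 z))"
    unfolding \<Theta>m_def domain_midpoint(2)[OF \<Theta>] by (simp add: matrix_scalar_ac matrix_add_ldistrib scaleR_add_right flip: scalar_matrix_assoc)
  also have "\<dots> = (1/2) * (tr_int (\<lambda>z. \<Omega> z ** X \<Theta>1 z) + tr_int (\<lambda>z. \<Omega> z ** X \<Theta>2 z))"
    by (simp only: tr_int_scaleR[OF circle_bdd_add[OF OX OX]] tr_int_add[OF OX OX])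
  finally have lin: "2 * tr_int (\<lambda>z. \<Omega> z ** X \<Theta>m z)
      = tr_int (\<lambda>z. \<Omega> z ** X \<Theta>1 z) + tr_int (\<lambda>z. \<Omega> z ** X \<Theta>2 z)" by simp
  have "tr_int F = tr_int (?p \<Theta>1) + tr_int (?p \<Theta>2) - 2 * tr_int (?p \<Theta>m)"
    unfolding F_def[abs_def]
    by (simp only: tr_int_diff tr_int_add tr_int_scaleR circle_bdd_penalty \<Theta> \<Theta>m circle_bdd_intros)
  also have "\<dots> = reduced_dual \<Omega> \<Theta>1 + reduced_dual \<Omega> \<Theta>2 - 2 * reduced_dual \<Omega> \<Theta>m"
    using lin by (simp add: reduced_dual_def)
  also have "\<dots> \<le> 0" using min[OF \<Theta>m] eq by simp
  finally have "AE t in lborel. t \<in> {-pi..pi} \<longrightarrow> Re (trace (F (cis t))) = 0"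
    using tr_int_nonpos_AE[OF F_bdd gap(1)] by blast
  then have ae: "AE t in lborel. t \<in> {-pi..pi} \<longrightarrow> X \<Theta>1 (cis t) - X \<Theta>2 (cis t) = 0"
  proof eventually_elim
    case (elim t)
    show ?case
    proof
      assume "t \<in> {-pi..pi}"
      have c: "cis t \<in> unit_circle" by simp
      \<comment> \<open>undo the congruence, as \<open>X\<close> is continuous but \<open>K\<close> need not be\<close>
      have "K \<Theta>1 (cis t) = K \<Theta>2 (cis t)" using elim \<open>t \<in> _\<close> gap(2)[OF c] by blast
      then have "S \<Theta>1 (cis t) = S \<Theta>2 (cis t)" by (simp only: S_kernel[OF c])
      then show "X \<Theta>1 (cis t) - X \<Theta>2 (cis t) = 0" using \<nu> by (simp add: S_def)
    qed
  qed
  have "X \<Theta>1 z - X \<Theta>2 z = 0"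
    by (rule continuous_circle_AE_zero[OF _ ae z]) (intro continuous_on_diff X_cont)
  then show ?thesis by (simp add: tau_density_def kernel_X)
qed

end

section \<open>Transfer function, prior and correlogram on the circle\<close>

text \<open>A point of the circle at which the resolvent fails to exist would be an eigenvalue of modulus one.\<close>

lemma schur_stable_resolvent:
  fixes A :: "real^'n^'n"
  assumes A: "schur_stable A" and z: "z \<in> unit_circle"
  shows "invertible (mat z - cmat A)"
proof -
  have "x = 0" if x: "(mat z - cmat A) *v x = 0" for x
  proof (rule ccontr)
    assume "x \<noteq> 0"
    have "mat z *v x = z *s x"
      by (simp add: vec_eq_iff matrix_vector_mult_def mat_def if_distrib[where f = "\<lambda>y. y * _"] cong: if_cong)
    then have "cmat A *v x = z *s x" using x by (simp add: matrix_vector_mult_diff_rdistrib)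
    then have "cmod z < 1" using A \<open>x \<noteq> 0\<close> unfolding schur_stable_def by blast
    then show False using z by simp
  qed
  then show ?thesis unfolding invertible_left_inverse matrix_left_invertible_ker by blast
qed

lemma continuous_on_mat [continuous_intros]:
  fixes f :: "'x::topological_space \<Rightarrow> complex"
  assumes "continuous_on S f"
  shows "continuous_on S (\<lambda>z. mat (f z) :: complex^'n^'n)"
proof (rule continuous_on_matrix_entries)
  show "continuous_on S (\<lambda>z. (mat (f z) :: complex^'n^'n) $ i $ j)" for i j
    by (cases "i = j") (auto simp: mat_def intro: assms)
qed

lemma transfer_fun_continuous:
  assumes "schur_stable A"
  shows "continuous_on unit_circle (transfer_fun A B)"
  unfolding transfer_fun_def[abs_def]
  by (intro continuous_on_matrix_mult continuous_on_matrix_inv continuous_intros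
      schur_stable_resolvent[OF assms])

lemma transfer_fun_cnj:
  assumes "schur_stable A" "z \<in> unit_circle"
  shows "transfer_fun A B (cnj z) = map_matrix cnj (transfer_fun A B z)"
proof -
  have "map_matrix cnj (mat z - cmat A) = mat (cnj z) - cmat A"
    by (simp add: vec_eq_iff mat_def cmat_def)
  then show ?thesis
    by (simp add: transfer_fun_def map_cnj_mult map_cnj_inverse[OF schur_stable_resolvent[OF assms]])
qed

lemma spec_densities_posdef:
  fixes \<Phi> :: "complex \<Rightarrow> complex^'m^'m"
  assumes \<Phi>: "\<Phi> \<in> spec_densities" and z: "z \<in> unit_circle"
  shows "posdef (\<Phi> z)"
proof -
  obtain k where k: "k > 0" "psd (\<Phi> z - k *\<^sub>R mat 1)" and H: "hermitian (\<Phi> z)"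
    using assms unfolding spec_densities_def by blast
  have "0 < Re (hform (\<Phi> z) v)" if "v \<noteq> 0" for v
  proof -
    have "(k *\<^sub>R mat 1 :: complex^'m^'m) *v v = k *\<^sub>R v"
      by (simp add: vec_eq_iff matrix_vector_mult_def mat_def complex_scaleR
          if_distrib[where f = "\<lambda>y. y * _"] if_distrib[where f = "\<lambda>y. _ * y"] cong: if_cong)
    then have "v \<bullet> ((\<Phi> z - k *\<^sub>R mat 1) *v v) = v \<bullet> (\<Phi> z *v v) - k * (v \<bullet> v)"
      by (simp add: matrix_vector_mult_diff_rdistrib inner_diff_right)
    moreover have "0 \<le> v \<bullet> ((\<Phi> z - k *\<^sub>R mat 1) *v v)"
      using k(2) unfolding psd_def Re_hform by blast
    ultimately have "k * (v \<bullet> v) \<le> Re (hform (\<Phi> z) v)" by (simp add: Re_hform)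
    then show ?thesis using k(1) that by (smt (verit) inner_gt_zero_iff mult_pos_pos)
  qed
  then show ?thesis using H by (simp add: posdef_def)
qed

lemma rational_on_circle_continuous:
  assumes "rational_on_circle F"
  shows "continuous_on unit_circle F"
proof (rule continuous_on_matrix_entries)
  fix i j
  obtain p q where pq: "\<forall>z\<in>unit_circle. poly q z \<noteq> 0 \<and> F z $ i $ j = poly p z / poly q z"
    using assms unfolding rational_on_circle_def by blast
  have "continuous_on unit_circle (\<lambda>z. poly p z / poly q z)"
    by (intro continuous_on_divide continuous_on_poly continuous_on_id) (use pq in blast)
  moreover have "continuous_on unit_circle (\<lambda>z. F z $ i $ j)
      \<longleftrightarrow> continuous_on unit_circle (\<lambda>z. poly p z / poly q z)"
    by (rule continuous_on_cong) (use pq in blast)+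
  ultimately show "continuous_on unit_circle (\<lambda>z. F z $ i $ j)" by blast
qed

lemma correlogram_continuous: "continuous_on unit_circle (correlogram w L N y)"
  unfolding correlogram_def[abs_def]
  by (intro continuous_on_sum continuous_on_matrix_mult continuous_on_mat continuous_intros) auto

theorem proposition3:
  fixes A :: "real^'n^'n" and B :: "real^'m^'n"
    and G :: "complex \<Rightarrow> complex^'m^'n"
    and \<Psi> W WQ \<Omega> :: "complex \<Rightarrow> complex^'m^'m"
    and w :: "nat \<Rightarrow> real" and L N :: nat and y :: "nat \<Rightarrow> real^'m"
    and \<Sigma> :: "complex^'n^'n" and \<nu> :: nat and \<Theta>h :: "real^'n^'n"
  assumes "CARD('m) < CARD('n)"
    and "schur_stable A" and "reachable A B"
    and "G = transfer_fun A B"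
    and "\<Psi> \<in> spec_densities" and "rational_on_circle \<Psi>"
    and "spectral_factor W \<Psi>"
    and "1 \<le> L" and "L \<le> N" and "w 0 = 1"
    and "\<Omega> = correlogram w L N y"
    and "\<forall>z\<in>unit_circle. posdef (\<Omega> z)"
    and "\<Sigma> = circle_integral (\<lambda>z. G z ** \<Omega> z ** hconj (G z))"
    and "spectral_factor WQ (\<lambda>z. matrix_inv (\<Psi> z))"
    and "1 \<le> \<nu>"
    and "is_arg_min (dual_fun G \<Psi> W \<Sigma> \<nu>) (\<lambda>\<Theta>. \<Theta> \<in> dual_domain G W \<nu>) \<Theta>h"
  shows "is_arg_min (\<lambda>\<Theta>. weighted_beta_div WQ (1 - 1 / real \<nu>) \<Omega> (tau_density G W \<nu> \<Theta>))
           (\<lambda>\<Theta>. \<Theta> \<in> dual_domain G W \<nu>) \<Theta>h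
       \<and> tau_density G W \<nu> \<Theta>h \<in> tau_class G W \<nu> \<inter> spec_densities
       \<and> (\<forall>\<Phi>\<in>tau_class G W \<nu>.
            (\<forall>z\<in>unit_circle. \<Phi> z = tau_density G W \<nu> \<Theta>h z)
            \<or> weighted_beta_div WQ (1 - 1 / real \<nu>) \<Omega> (tau_density G W \<nu> \<Theta>h)
              < weighted_beta_div WQ (1 - 1 / real \<nu>) \<Omega> \<Phi>)"
proof -
  note A = \<open>schur_stable A\<close> and \<Psi> = \<open>\<Psi> \<in> spec_densities\<close>
  interpret tau_family G \<Psi> W \<nu>
  proof
    show "continuous_on unit_circle G" using transfer_fun_continuous[OF A] \<open>G = _\<close> by simp
    show "G (cnj z) = map_matrix cnj (G z)" if "z \<in> unit_circle" for z
      using transfer_fun_cnj[OF A that] \<open>G = _\<close> by simp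
    show "continuous_on unit_circle \<Psi>"
      using \<open>rational_on_circle \<Psi>\<close> by (rule rational_on_circle_continuous)
    show "posdef (\<Psi> z)" if "z \<in> unit_circle" for z using \<Psi> that by (rule spec_densities_posdef)
    show "\<Psi> (cnj z) = map_matrix cnj (\<Psi> z)" if "z \<in> unit_circle" for z
      using \<Psi> that unfolding spec_densities_def by blast
  qed fact+
  have \<Omega>: "coercive \<Omega>"
  proof (rule coercive_continuous)
    show "continuous_on unit_circle \<Omega>" unfolding \<open>\<Omega> = _\<close> by (rule correlogram_continuous)
    show "posdef (\<Omega> z)" if "z \<in> unit_circle" for z
      using \<open>\<forall>z\<in>unit_circle. posdef (\<Omega> z)\<close> that by blast
  qed
  then have \<Omega>_bdd: "circle_bdd \<Omega>" by (simp add: coercive_def)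
  obtain c where dual: "\<And>\<Theta>. \<Theta> \<in> D \<Longrightarrow> dual_fun G \<Psi> W \<Sigma> \<nu> \<Theta> = c + reduced_dual \<Omega> \<Theta>"
    using \<Omega>_bdd \<open>\<Sigma> = _\<close> by (rule dual_fun_eq) blast
  obtain c' where div: "\<And>\<Theta>. \<Theta> \<in> D \<Longrightarrow>
      weighted_beta_div WQ (1 - 1 / real \<nu>) \<Omega> (T \<Theta>) = c' + reduced_dual \<Omega> \<Theta>"
    using \<Omega> \<open>spectral_factor WQ _\<close> by (rule weighted_beta_div_eq) blast
  have \<Theta>h: "\<Theta>h \<in> D" and "\<not> (\<exists>\<Theta>. \<Theta> \<in> D \<and> dual_fun G \<Psi> W \<Sigma> \<nu> \<Theta> < dual_fun G \<Psi> W \<Sigma> \<nu> \<Theta>h)"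
    using \<open>is_arg_min _ _ \<Theta>h\<close> unfolding is_arg_min_def by blast+
  then have min: "reduced_dual \<Omega> \<Theta>h \<le> reduced_dual \<Omega> \<Theta>" if "\<Theta> \<in> D" for \<Theta>
    using that dual[OF that] dual[OF \<Theta>h] by force
  have "is_arg_min (\<lambda>\<Theta>. weighted_beta_div WQ (1 - 1 / real \<nu>) \<Omega> (T \<Theta>)) (\<lambda>\<Theta>. \<Theta> \<in> D) \<Theta>h"
    unfolding is_arg_min_def using \<Theta>h min div by (auto simp: not_less)
  moreover have "T \<Theta>h \<in> tau_class G W \<nu> \<inter> spec_densities"
    using \<Theta>h T_spec_densities by (simp add: tau_class_def)
  moreover have "(\<forall>z\<in>unit_circle. T \<Theta> z = T \<Theta>h z)
      \<or> weighted_beta_div WQ (1 - 1 / real \<nu>) \<Omega> (T \<Theta>h) < weighted_beta_div WQ (1 - 1 / real \<nu>) \<Omega> (T \<Theta>)"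
    if \<Theta>: "\<Theta> \<in> D" for \<Theta>
  proof (cases "reduced_dual \<Omega> \<Theta>h = reduced_dual \<Omega> \<Theta>")
    case True
    then have "T \<Theta>h z = T \<Theta> z" if "z \<in> unit_circle" for z
      using reduced_dual_minimizers_agree[OF \<Omega>_bdd \<Theta>h \<Theta> True min that] by blast
    then show ?thesis by simp
  next
    case False
    then show ?thesis using min[OF \<Theta>] div[OF \<Theta>] div[OF \<Theta>h] by simp
  qed
  ultimately show ?thesis unfolding tau_class_def by blast
qed

end
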